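(* Suppose that $d<|a|$. (i) If $w\in\mathbb{C}$, $w\ne b$, then the Weierstrass–Hadamard factorization for $f$ is $$f(z)=w+(b-w)\prod_{\sigma\in\Sigma}\left(1-\frac{z}{g_{\sigma}(w)}\right),\qquad z\in\mathbb{C}.$$ In particular, $$f(z)=b\prod_{\sigma\in\Sigma}\left(1+\frac{z}{b}\prod_{n=1}^{\infty}\frac{Q\bigl(P_{\sigma_n}^{-1}\circ\cdots\circ P_{\sigma_1}^{-1}(0)\bigr)}{a}\right),\qquad z\in\mathbb{C}.$$ (ii) If $w=b$, then $$f(z)=b+z\prod_{m\ge 0}\prod_{\sigma\in\Sigma'}\left(1-\frac{z}{a^m g_{\sigma,0}}\right)=b+\left(\left\{\frac{z}{g_{\sigma,0}}\right\}_{\sigma\in\Sigma'};\frac1a\right)_{\infty}z,\qquad z\in\mathbb{C}.$$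
   Context: Let $P$ be a complex polynomial of degree $d\ge 2$ and let $b\in\mathbb{C}$, $b\ne 0$, be a repelling fixed point of $P$: $P(b)=b$ and $|a|>1$, where $a:=P'(b)$. Let $f$ be the entire solution of $f(az)=P(f(z))$ ($z\in\mathbb{C}$) with $f(0)=b$, $f'(0)=1$; it can be taken as $f(z)=\lim_{n\to\infty}P^{\circ n}(b+a^{-n}z)$, the convergence being uniform on compact sets. Branches of $P^{-1}$: fix functions $P_0^{-1},\dots,P_{d-1}^{-1}:\mathbb{C}\to\mathbb{C}$ such that for every $w\in\mathbb{C}$ the values $P_0^{-1}(w),\dots,P_{d-1}^{-1}(w)$ form a complete set of solutions $z$ of $P(z)=w$, counted with multiplicity. The principal branch $P_0^{-1}$ satisfies $P_0^{-1}(b)=b$ and is analytic in some open neighbourhood of $b$; otherwise the numbering of the branches is arbitrary. Standing assumption (Hypothesis 1): for every $w\in\mathbb{C}$, the $n$-fold iterate $(P_0^{-1})^{\circ n}(w)\to b$ as $n\to\infty$. $Q$ is the polynomial $Q(z):=\frac{P(z)-b}{z-b}$. With $\mathbb{N}=\{1,2,\dots\}$, $$\Sigma=\{\sigma:\mathbb{N}\to\{0,\dots,d-1\}:\ \lim_{n\to\infty}\sigma_n=0\},\qquad \Sigma'=\{\sigma\in\Sigma:\ \sigma_1\ne 0\}.$$ For $w\ne b$ and $\sigma\in\Sigma$, $$g_{\sigma}(w)=(w-b)\prod_{n=1}^{\infty}\frac{a}{Q\bigl(P^{-1}_{\sigma_n}\circ\cdots\circ P^{-1}_{\sigma_1}(w)\bigr)},$$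 and for $\sigma\in\Sigma'$, $$g_{\sigma,0}=\bigl(P_{\sigma_1}^{-1}(b)-b\bigr)\prod_{n=2}^{\infty}\frac{a}{Q\bigl(P^{-1}_{\sigma_n}\circ\cdots\circ P^{-1}_{\sigma_1}(b)\bigr)}.$$ The $q$-Pochhammer symbol is $(\{\alpha_i\}_{i\in R};\beta)_{\infty}:=\prod_{i\in R}\prod_{n=0}^{\infty}(1-\alpha_i\beta^n)$.
   Formalization: In (ii), g_{σ,0} is replaced by a·g_{σ,0} in both products: as printed it fails, e.g. for P(z)=z²−2, b=2, a=4, f(z)=2cosh√z, σ=(1,0,0,…), where g_{σ,0}=−π² but f(−π²)=−2≠b. *)

theory Defs
  imports "HOL-Analysis.Analysis" "HOL-Computational_Algebra.Computational_Algebra"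
begin

text \<open>
  Products over an unordered index set: the limit of the finite partial products along the
  net of finite subsets (the multiplicative counterpart of \<open>infsum\<close>).  A product may
  vanish because a factor vanishes.  Absolute convergence of a product \<open>\<Prod>(1 + u\<^sub>i)\<close> means
  \<open>\<Sum>\<bar>u\<^sub>i\<bar> < \<infinity>\<close>; it implies that the net converges.
\<close>

definition unordered_prod :: "('i \<Rightarrow> complex) \<Rightarrow> 'i set \<Rightarrow> complex" where
  "unordered_prod f A = Lim (finite_subsets_at_top A) (\<lambda>F. prod f F)"

definition abs_convergent_unordered_prod :: "('i \<Rightarrow> complex) \<Rightarrow> 'i set \<Rightarrow> bool" where
  "abs_convergent_unordered_prod f A \<longleftrightarrow> (\<lambda>i. norm (f i - 1)) summable_on A"

definition q_pochhammer :: "('i \<Rightarrow> complex) \<Rightarrow> 'i set \<Rightarrow> complex \<Rightarrow> complex" where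
  "q_pochhammer \<alpha> R \<beta> = unordered_prod (\<lambda>i. \<Prod>n. 1 - \<alpha> i * \<beta> ^ n) R"

text \<open>
  \<open>B 0, \<dots>, B (d - 1)\<close> (with \<open>d\<close> the degree of \<open>P\<close>) are branches of the inverse of \<open>P\<close>: at each
  \<open>w\<close> their values are the roots of \<open>P - w\<close>, with multiplicity.  No regularity in \<open>w\<close> is
  required, except of the principal branch \<open>B 0\<close> at \<open>b\<close>.
\<close>

definition inverse_branches ::
    "complex poly \<Rightarrow> complex \<Rightarrow> (nat \<Rightarrow> complex \<Rightarrow> complex) \<Rightarrow> bool" where
  "inverse_branches P b B \<longleftrightarrow>
     (\<forall>w. image_mset (\<lambda>i. B i w) (mset_set {..<degree P}) = proots (P - [:w:])) \<and>
     B 0 b = b \<and> (\<exists>U. open U \<and> b \<in> U \<and> B 0 analytic_on U)"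

definition Qpoly :: "complex poly \<Rightarrow> complex \<Rightarrow> complex poly" where
  "Qpoly P b = (P - [:b:]) div [:- b, 1:]"

text \<open>
  Sequences \<open>\<sigma>\<close> are indexed by the positive integers; the value at \<open>0\<close> is pinned to
  \<open>undefined\<close> so that each sequence is represented exactly once.
\<close>

definition Sigma_seqs :: "nat \<Rightarrow> (nat \<Rightarrow> nat) set" where
  "Sigma_seqs d = {\<sigma> \<in> {1..} \<rightarrow>\<^sub>E {..<d}. \<sigma> \<longlonglongrightarrow> 0}"

definition Sigma_seqs' :: "nat \<Rightarrow> (nat \<Rightarrow> nat) set" where
  "Sigma_seqs' d = {\<sigma> \<in> Sigma_seqs d. \<sigma> 1 \<noteq> 0}"

text \<open>\<open>backorbit B \<sigma> n w\<close> is \<open>(B (\<sigma> n) \<circ> \<dots> \<circ> B (\<sigma> 1)) w\<close>.\<close>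

primrec backorbit ::
    "(nat \<Rightarrow> complex \<Rightarrow> complex) \<Rightarrow> (nat \<Rightarrow> nat) \<Rightarrow> nat \<Rightarrow> complex \<Rightarrow> complex" where
  "backorbit B \<sigma> 0 w = w"
| "backorbit B \<sigma> (Suc n) w = B (\<sigma> (Suc n)) (backorbit B \<sigma> n w)"

definition g_factor ::
    "complex poly \<Rightarrow> complex \<Rightarrow> (nat \<Rightarrow> complex \<Rightarrow> complex) \<Rightarrow> (nat \<Rightarrow> nat) \<Rightarrow> complex \<Rightarrow> nat \<Rightarrow> complex"
  where
  "g_factor P b B \<sigma> w n = poly (pderiv P) b / poly (Qpoly P b) (backorbit B \<sigma> n w)"

definition g_sigma ::
    "complex poly \<Rightarrow> complex \<Rightarrow> (nat \<Rightarrow> complex \<Rightarrow> complex) \<Rightarrow> (nat \<Rightarrow> nat) \<Rightarrow> complex \<Rightarrow> complex"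
  where
  "g_sigma P b B \<sigma> w = (w - b) * (\<Prod>n. g_factor P b B \<sigma> w (n + 1))"

text \<open>
  Since \<open>Q (z\<^sub>n) = (z\<^sub>n\<^sub>-\<^sub>1 - b) / (z\<^sub>n - b)\<close> along a backward orbit \<open>z\<close> of \<open>b\<close> with \<open>z\<^sub>1 \<noteq> b\<close>, the number
  \<open>g_sigma0\<close> below is the limit of \<open>a\<^sup>n\<^sup>-\<^sup>1 (z\<^sub>n - b)\<close>, where \<open>a\<close> is the multiplier at \<open>b\<close>.  So the
  Poincare function \<open>f\<close> takes the value \<open>z\<^sub>1\<close> at \<open>g_sigma0\<close>, and its first \<open>b\<close>-point on this
  orbit is \<open>a * g_sigma0\<close>: the nonzero \<open>b\<close>-points of \<open>f\<close> are \<open>a ^ m * (a * g_sigma0)\<close>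
  for \<open>m \<ge> 0\<close>.  The extra factor \<open>a\<close> cannot be dropped.  For \<open>P = z\<^sup>2 - 2\<close> and \<open>b = 2\<close> one has
  \<open>a = 4\<close> and \<open>f z = 2 cosh (sqrt z)\<close>; the sequence \<open>\<sigma> = (1, 0, 0, \<dots>)\<close> gives \<open>g_sigma0 = - pi\<^sup>2\<close>,
  and \<open>f (- pi\<^sup>2) = - 2\<close> whereas \<open>f (- 4 pi\<^sup>2) = 2\<close>.
\<close>

definition g_sigma0 ::
    "complex poly \<Rightarrow> complex \<Rightarrow> (nat \<Rightarrow> complex \<Rightarrow> complex) \<Rightarrow> (nat \<Rightarrow> nat) \<Rightarrow> complex"
  where
  "g_sigma0 P b B \<sigma> = (B (\<sigma> 1) b - b) * (\<Prod>n. g_factor P b B \<sigma> b (n + 2))"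

end

theory Submission
  imports Defs "HOL-Complex_Analysis.Conformal_Mappings"
begin

text \<open>
  No growth theory of entire functions is needed.  Iterating \<open>P y - w = c \<Prod>\<^sub>i (y - B i w)\<close> and using
  \<open>P b = b\<close> gives, with \<open>y = f (z / a\<^sup>n)\<close>, the exact finite factorization
  \<open>(f z - w) / (b - w) = \<Prod>\<^sub>\<sigma> (1 - (y - b) / (z\<^sub>\<sigma>\<^sub>,\<^sub>n - b))\<close> over the words \<open>\<sigma>\<close> of length \<open>n\<close>, where
  \<open>z\<^sub>\<sigma>\<^sub>,\<^sub>n\<close> is the endpoint of the backward orbit of \<open>w\<close>; its factors tend to \<open>1 - z / g\<^sub>\<sigma>(w)\<close>.
  To pass to the limit in the product one needs \<open>\<bar>a\<^sup>n (z\<^sub>\<sigma>\<^sub>,\<^sub>n - b)\<bar> \<ge> c \<bar>a\<bar>\<^sup>l\<close>, where \<open>l\<close> is the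
  position of the last nonzero digit of \<open>\<sigma>\<close>.  This holds because \<open>B i\<close> with \<open>i \<noteq> 0\<close> keeps away from \<open>b\<close>,
  so that \<open>z\<^sub>\<sigma>\<^sub>,\<^sub>l\<close> does, while the \<open>n - l\<close> remaining forward steps expand by at most about
  \<open>\<bar>a\<bar>\<^sup>n\<^sup>-\<^sup>l\<close> near \<open>b\<close>.  As there are at most \<open>d\<^sup>l\<close> such \<open>\<sigma>\<close> and \<open>d < \<bar>a\<bar>\<close>, the bounds are summable.
  Part (ii) follows from part (i) at the points \<open>w = B i b\<close>, whose product is \<open>Q (f z) / a\<close>, by
  telescoping \<open>f z - b = (f (z / a) - b) Q (f (z / a))\<close>.
\<close>

subsection \<open>Unordered products\<close>

text \<open>Induction with \<open>1 + x \<le> exp x\<close>. The exponential majorant is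
  multiplicative, and nothing is divided by a factor, so factors may vanish.\<close>

lemma norm_prod_minus_1_le:
  fixes f :: "'i \<Rightarrow> complex"
  assumes "\<And>i. i \<in> G \<Longrightarrow> norm (f i - 1) \<le> M i"
  shows "norm (prod f G - 1) \<le> exp (sum M G) - 1"
  using assms
proof (induction G rule: infinite_finite_induct)
  case (insert x G)
  have M: "norm (f x - 1) \<le> M x" and IH: "norm (prod f G - 1) \<le> exp (sum M G) - 1"
    using insert by auto
  have M0: "0 \<le> M x"
    using M norm_ge_zero order_trans by blast
  have "norm (f x) \<le> 1 + M x"
    using norm_triangle_ineq[of "f x - 1" 1] M by simp
  then have "norm (f x * (prod f G - 1)) \<le> (1 + M x) * (exp (sum M G) - 1)"
    unfolding norm_mult using IH M0 by (intro mult_mono) auto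
  moreover have "f x * prod f G - 1 = f x * (prod f G - 1) + (f x - 1)"
    by (simp add: algebra_simps)
  ultimately have "norm (f x * prod f G - 1) \<le> (1 + M x) * exp (sum M G) - 1"
    using norm_triangle_ineq[of "f x * (prod f G - 1)" "f x - 1"] M by (simp add: algebra_simps)
  also have "\<dots> \<le> exp (M x) * exp (sum M G) - 1"
    by simp
  finally show ?case
    using insert.hyps by (simp add: exp_add)
qed auto

text \<open>Split off \<open>prod f F\<close> and compare the product over \<open>G - F\<close> with
  1. The bound is an increment of \<open>exp (sum M F)\<close>, the form needed for a Cauchy
  estimate.\<close>

lemma norm_prod_diff_le:
  fixes f :: "'i \<Rightarrow> complex"
  assumes "finite G" "F \<subseteq> G" and M: "\<And>i. i \<in> G \<Longrightarrow> norm (f i - 1) \<le> M i"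
  shows "norm (prod f G - prod f F) \<le> exp (sum M G) - exp (sum M F)"
proof -
  have "norm (prod f F - 1) \<le> exp (sum M F) - 1"
    using assms by (intro norm_prod_minus_1_le) auto
  then have 1: "norm (prod f F) \<le> exp (sum M F)"
    using norm_triangle_ineq[of "prod f F - 1" 1] by simp
  have 2: "norm (prod f (G - F) - 1) \<le> exp (sum M (G - F)) - 1"
    using assms by (intro norm_prod_minus_1_le) auto
  have "prod f G - prod f F = prod f F * (prod f (G - F) - 1)"
    using assms(1,2) by (simp add: prod.subset_diff[of F G f] algebra_simps)
  then have "norm (prod f G - prod f F) \<le> exp (sum M F) * (exp (sum M (G - F)) - 1)"
    by (simp add: norm_mult mult_mono 1 2)
  also have "\<dots> = exp (sum M G) - exp (sum M F)"
    using assms(1,2) by (simp add: sum.subset_diff[of F G M] algebra_simps flip: exp_add)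
  finally show ?thesis .
qed

text \<open>\<open>Lim\<close> carries information only once a limit exists. The partial products
  form a Cauchy net, since their increments are dominated by those of the convergent net
  \<open>exp (sum M F)\<close>.\<close>

lemma tendsto_unordered_prod:
  assumes "abs_convergent_unordered_prod f A"
  shows "(prod f \<longlongrightarrow> unordered_prod f A) (finite_subsets_at_top A)"
proof -
  define M where "M = (\<lambda>i. norm (f i - 1))"
  have M: "M summable_on A"
    using assms by (simp add: M_def abs_convergent_unordered_prod_def)
  define S where "S = exp (infsum M A)"
  have lim: "((\<lambda>F. exp (sum M F)) \<longlongrightarrow> S) (finite_subsets_at_top A)"
    unfolding S_def by (intro tendsto_exp infsum_tendsto M)
  have le: "norm (prod f G - prod f F) \<le> S - exp (sum M F)"
    if "finite G" "F \<subseteq> G" "G \<subseteq> A" for F G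
  proof -
    have "sum M G \<le> infsum M A"
      using that by (intro finite_sum_le_infsum M) (auto simp: M_def)
    then have "exp (sum M G) \<le> S"
      by (simp add: S_def)
    moreover have "norm (prod f G - prod f F) \<le> exp (sum M G) - exp (sum M F)"
      using that by (intro norm_prod_diff_le) (auto simp: M_def)
    ultimately show ?thesis
      by linarith
  qed
  have "cauchy_filter (filtermap (prod f) (finite_subsets_at_top A))"
    unfolding cauchy_filter_metric_filtermap
  proof (intro allI impI)
    fix e :: real
    assume "e > 0"
    then have "eventually (\<lambda>F. dist (exp (sum M F)) S < e / 2) (finite_subsets_at_top A)"
      using lim by (intro tendstoD) auto
    then obtain F where F: "finite F" "F \<subseteq> A" and d: "dist (exp (sum M F)) S < e / 2"
      unfolding eventually_finite_subsets_at_top by auto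
    have *: "norm (prod f G - prod f F) < e / 2" if "finite G" "F \<subseteq> G" "G \<subseteq> A" for G
      using le[OF that] d unfolding dist_real_def by linarith
    have "dist (prod f G) (prod f H) < e"
      if "finite G" "F \<subseteq> G" "G \<subseteq> A" "finite H" "F \<subseteq> H" "H \<subseteq> A" for G H
      using *[OF that(1-3)] *[OF that(4-6)]
      by (metis dist_commute dist_norm dist_triangle_half_r)
    then show "\<exists>R. eventually R (finite_subsets_at_top A) \<and>
                 (\<forall>G H. R G \<and> R H \<longrightarrow> dist (prod f G) (prod f H) < e)"
      using F by (intro exI[of _ "\<lambda>G. finite G \<and> F \<subseteq> G \<and> G \<subseteq> A"])
        (auto simp: eventually_finite_subsets_at_top)
  qed
  moreover have "filtermap (prod f) (finite_subsets_at_top A) \<noteq> bot"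
    by (simp add: filtermap_bot_iff)
  ultimately obtain L where "filtermap (prod f) (finite_subsets_at_top A) \<le> nhds L"
    using cauchy_filter_complete_converges[OF _ complete_UNIV] by auto
  then have L: "(prod f \<longlongrightarrow> L) (finite_subsets_at_top A)"
    by (simp add: filterlim_def)
  then have "unordered_prod f A = L"
    unfolding unordered_prod_def using tendsto_Lim[OF _ L] by simp
  then show ?thesis
    using L by simp
qed

lemma unordered_prod_eqI:
  assumes "(prod f \<longlongrightarrow> L) (finite_subsets_at_top A)"
  shows "unordered_prod f A = L"
  unfolding unordered_prod_def using tendsto_Lim[OF _ assms] by simp

lemma unordered_prod_cong:
  assumes "\<And>i. i \<in> A \<Longrightarrow> f i = g i"
  shows "unordered_prod f A = unordered_prod g A"
proof -
  have "eventually (\<lambda>F. prod f F = prod g F) (finite_subsets_at_top A)"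
    using assms by (intro eventually_finite_subsets_at_top_weakI prod.cong) auto
  \<comment> \<open>No convergence is assumed: the two nets have the same limits, so the description
    behind \<open>Lim\<close> picks the same value.\<close>
  then show ?thesis
    unfolding unordered_prod_def Topological_Spaces.Lim_def by (simp add: tendsto_cong)
qed

lemma abs_convergent_unordered_prod_cong:
  assumes "\<And>i. i \<in> A \<Longrightarrow> f i = g i"
  shows "abs_convergent_unordered_prod f A \<longleftrightarrow> abs_convergent_unordered_prod g A"
  unfolding abs_convergent_unordered_prod_def using assms by (intro summable_on_cong) simp

text \<open>Lets finite products over words be read as products over the whole index set, so that
  all stages of an approximation share one set.\<close>

lemma unordered_prod_finite_support:
  assumes "finite F" "F \<subseteq> A" "\<And>i. i \<in> A - F \<Longrightarrow> f i = 1"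
  shows "unordered_prod f A = prod f F"
proof (rule unordered_prod_eqI, rule tendsto_eventually)
  show "eventually (\<lambda>G. prod f G = prod f F) (finite_subsets_at_top A)"
    unfolding eventually_finite_subsets_at_top
    using assms by (intro exI[of _ F] conjI allI impI) (auto intro!: prod.mono_neutral_right)
qed

lemma abs_convergent_unordered_prod_comparison:
  assumes "M summable_on A" "\<And>i. i \<in> A \<Longrightarrow> norm (f i - 1) \<le> M i"
  shows "abs_convergent_unordered_prod f A"
  unfolding abs_convergent_unordered_prod_def
  by (rule summable_on_comparison_test[OF assms(1)]) (use assms(2) in auto)

lemma norm_unordered_prod_diff_le:
  assumes M: "M summable_on A" "\<And>i. i \<in> A \<Longrightarrow> norm (f i - 1) \<le> M i"
    and F: "finite F" "F \<subseteq> A"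
  shows "norm (unordered_prod f A - prod f F) \<le> exp (infsum M A) - exp (sum M F)"
proof -
  have lim: "((\<lambda>G. norm (prod f G - prod f F)) \<longlongrightarrow> norm (unordered_prod f A - prod f F))
      (finite_subsets_at_top A)"
    using M by (intro tendsto_intros tendsto_unordered_prod abs_convergent_unordered_prod_comparison)
  have "norm (prod f G - prod f F) \<le> exp (infsum M A) - exp (sum M F)"
    if "finite G" "F \<subseteq> G" "G \<subseteq> A" for G
  proof -
    have "sum M G \<le> infsum M A"
      using that M(2) by (intro finite_sum_le_infsum M(1)) (auto intro: order_trans[OF norm_ge_zero])
    then have "exp (sum M G) \<le> exp (infsum M A)"
      by simp
    moreover have "norm (prod f G - prod f F) \<le> exp (sum M G) - exp (sum M F)"
      using that M(2) by (intro norm_prod_diff_le) auto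
    ultimately show ?thesis
      by linarith
  qed
  then show ?thesis
    using F by (intro tendsto_upperbound[OF lim])
      (auto simp: eventually_finite_subsets_at_top finite_subsets_at_top_neq_bot)
qed

text \<open>Dominated convergence: outside a finite \<open>F\<close> the majorant controls all
  \<open>n\<close> at once, and on \<open>F\<close> the product is finite.\<close>

lemma tannery_unordered_prod:
  assumes M: "M summable_on A" "\<And>n i. i \<in> A \<Longrightarrow> norm (f n i - 1) \<le> M i"
    and lim: "\<And>i. i \<in> A \<Longrightarrow> (\<lambda>n. f n i) \<longlonglongrightarrow> g i"
  shows "(\<lambda>n. unordered_prod (f n) A) \<longlonglongrightarrow> unordered_prod g A"
proof (rule metric_LIMSEQ_I)
  fix e :: real
  assume e: "e > 0"
  have Mg: "norm (g i - 1) \<le> M i" if "i \<in> A" for i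
    by (rule LIMSEQ_le_const2[of "\<lambda>n. norm (f n i - 1)"])
      (use M(2) that in \<open>auto intro!: tendsto_intros lim\<close>)
  have "((\<lambda>F. exp (sum M F)) \<longlongrightarrow> exp (infsum M A)) (finite_subsets_at_top A)"
    by (intro tendsto_exp infsum_tendsto M)
  then have "eventually (\<lambda>F. dist (exp (sum M F)) (exp (infsum M A)) < e / 3)
      (finite_subsets_at_top A)"
    using e by (intro tendstoD) auto
  then obtain F where F: "finite F" "F \<subseteq> A"
    and d: "dist (exp (sum M F)) (exp (infsum M A)) < e / 3"
    unfolding eventually_finite_subsets_at_top by auto
  have 1: "norm (unordered_prod (f n) A - prod (f n) F) < e / 3" for n
    using norm_unordered_prod_diff_le[of M A "f n", OF M(1) M(2) F] d unfolding dist_real_def by linarith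
  have 2: "norm (unordered_prod g A - prod g F) < e / 3"
    using norm_unordered_prod_diff_le[OF M(1) Mg F] d unfolding dist_real_def by linarith
  have "(\<lambda>n. prod (f n) F) \<longlonglongrightarrow> prod g F"
    using F by (intro tendsto_prod lim) auto
  from metric_LIMSEQ_D[OF this, of "e / 3"] e obtain N where N: "\<And>n. n \<ge> N \<Longrightarrow> dist (prod (f n) F) (prod g F) < e / 3"
    by auto
  have "dist (unordered_prod (f n) A) (unordered_prod g A) < e" if "n \<ge> N" for n
  proof -
    have "dist (unordered_prod (f n) A) (unordered_prod g A) \<le>
        dist (unordered_prod (f n) A) (prod (f n) F) + dist (prod (f n) F) (prod g F)
        + dist (unordered_prod g A) (prod g F)"
      by metric
    then show ?thesis
      using 1[of n] 2 N[OF that] by (simp add: dist_norm)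
  qed
  then show "\<exists>N. \<forall>n\<ge>N. dist (unordered_prod (f n) A) (unordered_prod g A) < e"
    by blast
qed

text \<open>Dominated convergence, with the factors outside \<open>G n\<close> replaced by
  1.\<close>

lemma prod_exhaustion_tendsto_unordered_prod:
  assumes "abs_convergent_unordered_prod f A"
    and G: "\<And>n. finite (G n)" "\<And>n. G n \<subseteq> A"
    and ev: "\<And>i. i \<in> A \<Longrightarrow> eventually (\<lambda>n. i \<in> G n) sequentially"
  shows "(\<lambda>n. prod f (G n)) \<longlonglongrightarrow> unordered_prod f A"
proof -
  have "(\<lambda>n. unordered_prod (\<lambda>i. if i \<in> G n then f i else 1) A) \<longlonglongrightarrow> unordered_prod f A"
  proof (rule tannery_unordered_prod)
    show "(\<lambda>i. norm (f i - 1)) summable_on A"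
      using assms(1) by (simp add: abs_convergent_unordered_prod_def)
    show "(\<lambda>n. if i \<in> G n then f i else 1) \<longlonglongrightarrow> f i" if "i \<in> A" for i
      by (rule tendsto_eventually) (rule eventually_mono[OF ev[OF that]], simp)
  qed auto
  moreover have "unordered_prod (\<lambda>i. if i \<in> G n then f i else 1) A = prod f (G n)" for n
    by (subst unordered_prod_finite_support[of "G n"]) (use G in auto)
  ultimately show ?thesis
    by simp
qed

lemma prod_unordered_prod:
  assumes "finite I" "\<And>m. m \<in> I \<Longrightarrow> abs_convergent_unordered_prod (f m) A"
  shows "(\<Prod>m\<in>I. unordered_prod (f m) A) = unordered_prod (\<lambda>i. \<Prod>m\<in>I. f m i) A"
proof (rule unordered_prod_eqI[symmetric])
  have "((\<lambda>F. \<Prod>m\<in>I. prod (f m) F) \<longlongrightarrow> (\<Prod>m\<in>I. unordered_prod (f m) A)) (finite_subsets_at_top A)"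
    using assms by (intro tendsto_prod tendsto_unordered_prod)
  then show "((\<lambda>F. \<Prod>i\<in>F. \<Prod>m\<in>I. f m i) \<longlongrightarrow> (\<Prod>m\<in>I. unordered_prod (f m) A)) (finite_subsets_at_top A)"
    by (subst prod.swap)
qed

text \<open>Exchanges the products over \<open>m\<close> and \<open>i\<close>: finitely many
  \<open>m\<close> commute with the net limit, and \<open>N\<close> then tends to infinity under a
  majorant. With \<open>t i\<close> of the form \<open>z / G\<close>, both forms of part (ii) come
  from here.\<close>

lemma unordered_prod_geometric_swap:
  fixes a :: complex and t :: "'i \<Rightarrow> complex"
  assumes a: "norm a > 1" and t: "(\<lambda>i. norm (t i)) summable_on A"
  shows "\<And>i. convergent_prod (\<lambda>n. 1 - t i * (1 / a) ^ n)"
    and "abs_convergent_unordered_prod (\<lambda>i. \<Prod>n. 1 - t i * (1 / a) ^ n) A"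
    and "convergent_prod (\<lambda>m. unordered_prod (\<lambda>i. 1 - t i * (1 / a) ^ m) A)"
    and "(\<lambda>N. \<Prod>m<N. unordered_prod (\<lambda>i. 1 - t i * (1 / a) ^ m) A)
           \<longlonglongrightarrow> unordered_prod (\<lambda>i. \<Prod>n. 1 - t i * (1 / a) ^ n) A"
proof -
  define q where "q = norm (1 / a)"
  have q: "0 \<le> q" "q < 1"
    using a by (auto simp: q_def norm_divide divide_less_eq_1)
  have sq: "summable (\<lambda>n. q ^ n)"
    using q by (simp add: summable_geometric)
  define K where "K = (\<Sum>n. q ^ n)"
  show conv: "convergent_prod (\<lambda>n. 1 - t i * (1 / a) ^ n)" for i
  proof (rule abs_convergent_prod_imp_convergent_prod)
    have "summable (\<lambda>n. norm (t i) * q ^ n)"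
      by (intro summable_mult sq)
    then show "abs_convergent_prod (\<lambda>n. 1 - t i * (1 / a) ^ n)"
      unfolding abs_convergent_prod_conv_summable by (simp add: norm_mult norm_power q_def)
  qed
  have partial: "norm ((\<Prod>n<N. 1 - t i * (1 / a) ^ n) - 1) \<le> exp (norm (t i) * K) - 1" for N i
  proof -
    have "norm ((\<Prod>n<N. 1 - t i * (1 / a) ^ n) - 1) \<le> exp (\<Sum>n<N. norm (t i) * q ^ n) - 1"
      by (rule norm_prod_minus_1_le) (simp add: norm_mult norm_power q_def)
    also have "(\<Sum>n<N. norm (t i) * q ^ n) \<le> norm (t i) * K"
      unfolding sum_distrib_left[symmetric] K_def
      using q by (intro mult_left_mono sum_le_suminf sq) auto
    finally show ?thesis by simp
  qed
  define T where "T = infsum (\<lambda>i. norm (t i)) A"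
  have K0: "K \<ge> 0"
    unfolding K_def using q by (intro suminf_nonneg sq) auto
  \<comment> \<open>\<open>exp x - 1 \<le> x * exp x\<close> at \<open>x = norm (t i) * K\<close>,
    with \<open>norm (t i) \<le> T\<close> used in the exponent only, leaves a bound linear in
    \<open>norm (t i)\<close>, hence summable.\<close>
  define M where "M = (\<lambda>i. K * exp (T * K) * norm (t i))"
  have M: "M summable_on A"
    unfolding M_def by (intro summable_on_cmult_right t)
  have exp_le: "exp x - 1 \<le> x * exp x" for x :: real
  proof -
    have "1 - x \<le> exp (- x)"
      using exp_ge_add_one_self[of "- x"] by simp
    then have "(1 - x) * exp x \<le> exp (- x) * exp x"
      by (intro mult_right_mono) auto
    then show ?thesis
      by (simp add: algebra_simps flip: exp_add)
  qed
  have le_M: "norm ((\<Prod>n<N. 1 - t i * (1 / a) ^ n) - 1) \<le> M i" if "i \<in> A" for i N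
  proof -
    have "norm (t i) \<le> T"
      using finite_sum_le_infsum[OF t, of "{i}"] that by (simp add: T_def)
    then have "exp (norm (t i) * K) \<le> exp (T * K)"
      using K0 by (simp add: mult_right_mono)
    then have "norm (t i) * K * exp (norm (t i) * K) \<le> norm (t i) * K * exp (T * K)"
      using K0 by (intro mult_left_mono) auto
    then show ?thesis
      using partial[of i N] exp_le[of "norm (t i) * K"] by (simp add: M_def mult_ac)
  qed
  have lim: "(\<lambda>N. \<Prod>n<N. 1 - t i * (1 / a) ^ n) \<longlonglongrightarrow> (\<Prod>n. 1 - t i * (1 / a) ^ n)" for i
    using convergent_prod_LIMSEQ[OF conv] by (simp add: LIMSEQ_lessThan_iff_atMost)
  have "norm ((\<Prod>n. 1 - t i * (1 / a) ^ n) - 1) \<le> M i" if "i \<in> A" for i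
    by (rule LIMSEQ_le_const2[OF tendsto_norm[OF tendsto_diff[OF lim tendsto_const]]])
      (use le_M[OF that] in auto)
  then show "abs_convergent_unordered_prod (\<lambda>i. \<Prod>n. 1 - t i * (1 / a) ^ n) A"
    by (rule abs_convergent_unordered_prod_comparison[OF M])
  show "convergent_prod (\<lambda>m. unordered_prod (\<lambda>i. 1 - t i * (1 / a) ^ m) A)"
  proof (rule abs_convergent_prod_imp_convergent_prod)
    have "norm (unordered_prod (\<lambda>i. 1 - t i * (1 / a) ^ m) A - 1) \<le> T * exp T * q ^ m" for m
    proof -
      have T0: "T \<ge> 0"
        unfolding T_def by (rule infsum_nonneg) simp
      \<comment> \<open>Taking \<open>F = {}\<close>, whose product is 1, measures the distance of
        the full product from 1.\<close>
      have "norm (unordered_prod (\<lambda>i. 1 - t i * (1 / a) ^ m) A - prod (\<lambda>i. 1 - t i * (1 / a) ^ m) {})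
          \<le> exp (infsum (\<lambda>i. norm (t i) * q ^ m) A) - exp (sum (\<lambda>i. norm (t i) * q ^ m) {})"
        by (rule norm_unordered_prod_diff_le)
          (auto simp: norm_mult norm_power q_def intro: summable_on_cmult_left t)
      also have "\<dots> = exp (T * q ^ m) - 1"
        by (simp add: infsum_cmult_left t T_def)
      also have "\<dots> \<le> T * q ^ m * exp (T * q ^ m)"
        by (rule exp_le)
      also have "\<dots> \<le> T * q ^ m * exp T"
        using T0 q power_le_one[of q m] by (intro mult_left_mono) (auto intro: mult_left_le)
      finally show ?thesis
        by (simp add: mult_ac)
    qed
    then show "abs_convergent_prod (\<lambda>m. unordered_prod (\<lambda>i. 1 - t i * (1 / a) ^ m) A)"
      unfolding abs_convergent_prod_conv_summable
      by (intro summable_comparison_test'[OF summable_mult[OF sq, of "T * exp T"], of 0]) auto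
  qed
  have "(\<lambda>N. unordered_prod (\<lambda>i. \<Prod>m<N. 1 - t i * (1 / a) ^ m) A)
      \<longlonglongrightarrow> unordered_prod (\<lambda>i. \<Prod>n. 1 - t i * (1 / a) ^ n) A"
    by (rule tannery_unordered_prod[OF M le_M lim])
  moreover have "unordered_prod (\<lambda>i. \<Prod>m<N. 1 - t i * (1 / a) ^ m) A
      = (\<Prod>m<N. unordered_prod (\<lambda>i. 1 - t i * (1 / a) ^ m) A)" for N
  proof (rule prod_unordered_prod[symmetric])
    show "abs_convergent_unordered_prod (\<lambda>i. 1 - t i * (1 / a) ^ m) A" for m
      by (rule abs_convergent_unordered_prod_comparison[of "\<lambda>i. norm (t i) * q ^ m"])
        (auto simp: norm_mult norm_power q_def intro: summable_on_cmult_left t)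
  qed simp
  ultimately show "(\<lambda>N. \<Prod>m<N. unordered_prod (\<lambda>i. 1 - t i * (1 / a) ^ m) A)
           \<longlonglongrightarrow> unordered_prod (\<lambda>i. \<Prod>n. 1 - t i * (1 / a) ^ n) A"
    by simp
qed

subsection \<open>Digit sequences\<close>

text \<open>\<open>nat\<close> is discrete, so converging to 0 means being 0 from some index
  on.\<close>

lemma Sigma_seqs_iff:
  assumes "d > 0"
  shows "\<sigma> \<in> Sigma_seqs d \<longleftrightarrow>
    \<sigma> 0 = undefined \<and> (\<forall>k\<ge>1. \<sigma> k < d) \<and> (\<exists>l. \<forall>k>l. \<sigma> k = 0)"
proof -
  have "(\<sigma> \<longlonglongrightarrow> 0) \<longleftrightarrow> (\<exists>l. \<forall>k>l. \<sigma> k = 0)"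
    unfolding tendsto_discrete eventually_sequentially
    by (metis Suc_le_eq less_imp_le_nat)
  moreover have "k \<notin> {1..} \<longleftrightarrow> k = 0" for k :: nat
    by auto
  ultimately show ?thesis
    by (auto simp: Sigma_seqs_def PiE_iff extensional_def)
qed

text \<open>Words of length at most \<open>n\<close> are padded by zeros rather than encoded as
  lists, so that they form a subset of the index set of the product.\<close>

definition words :: "nat \<Rightarrow> nat \<Rightarrow> (nat \<Rightarrow> nat) set" where
  "words d n = {\<sigma> \<in> Sigma_seqs d. \<forall>k>n. \<sigma> k = 0}"

definition words' :: "nat \<Rightarrow> nat \<Rightarrow> (nat \<Rightarrow> nat) set" where
  "words' d n = {\<sigma> \<in> Sigma_seqs' d. \<forall>k>n. \<sigma> k = 0}"

text \<open>For sequences in \<open>Sigma_seqs d\<close> this is the position of the last nonzero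
  digit, or 0 if there is none; the pinned value at index 0 is never inspected.\<close>

definition word_length :: "(nat \<Rightarrow> nat) \<Rightarrow> nat" where
  "word_length \<sigma> = (LEAST l. \<forall>k>l. \<sigma> k = 0)"

definition word_Cons :: "nat \<Rightarrow> (nat \<Rightarrow> nat) \<Rightarrow> nat \<Rightarrow> nat" where
  "word_Cons i \<sigma> k = (if k = 0 then undefined else if k = 1 then i else \<sigma> (k - 1))"

lemma words_iff:
  assumes "d > 0"
  shows "\<sigma> \<in> words d n \<longleftrightarrow> \<sigma> 0 = undefined \<and> (\<forall>k\<ge>1. \<sigma> k < d) \<and> (\<forall>k>n. \<sigma> k = 0)"
  using Sigma_seqs_iff[OF assms] by (auto simp: words_def)

lemma words'_iff: "\<sigma> \<in> words' d n \<longleftrightarrow> \<sigma> \<in> words d n \<and> \<sigma> 1 \<noteq> 0"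
  by (auto simp: words_def words'_def Sigma_seqs'_def)

lemma word_length_spec:
  assumes "d > 0" "\<sigma> \<in> Sigma_seqs d" "k > word_length \<sigma>"
  shows "\<sigma> k = 0"
proof -
  obtain l where "\<forall>k>l. \<sigma> k = 0"
    using assms Sigma_seqs_iff by blast
  then have "\<forall>k>word_length \<sigma>. \<sigma> k = 0"
    unfolding word_length_def by (rule LeastI)
  then show ?thesis
    using assms by blast
qed

lemma word_length_le: "(\<And>k. k > l \<Longrightarrow> \<sigma> k = 0) \<Longrightarrow> word_length \<sigma> \<le> l"
  unfolding word_length_def by (rule Least_le) auto

lemma last_digit_nonzero:
  assumes "d > 0" "\<sigma> \<in> Sigma_seqs d" "word_length \<sigma> > 0"
  shows "\<sigma> (word_length \<sigma>) \<noteq> 0"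
proof
  assume 0: "\<sigma> (word_length \<sigma>) = 0"
  have "word_length \<sigma> \<le> word_length \<sigma> - 1"
  proof (rule word_length_le)
    show "\<sigma> k = 0" if "k > word_length \<sigma> - 1" for k
      using word_length_spec[OF assms(1,2), of k] 0 that
      by (cases "k = word_length \<sigma>") auto
  qed
  then show False
    using assms by simp
qed

lemma words_word_length: "d > 0 \<Longrightarrow> \<sigma> \<in> Sigma_seqs d \<Longrightarrow> \<sigma> \<in> words d n \<longleftrightarrow> word_length \<sigma> \<le> n"
  using word_length_spec word_length_le[of n \<sigma>] by (force simp: words_def)

lemma words_subset: "words d n \<subseteq> Sigma_seqs d"
  by (auto simp: words_def)

lemma words'_subset: "words' d n \<subseteq> Sigma_seqs' d"
  by (auto simp: words'_def)

lemma eventually_in_words: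
  assumes "d > 0" "\<sigma> \<in> Sigma_seqs d"
  shows "eventually (\<lambda>n. \<sigma> \<in> words d n) sequentially"
  using eventually_ge_at_top[of "word_length \<sigma>"] by eventually_elim (simp add: words_word_length assms)

lemma eventually_in_words':
  assumes "d > 0" "\<sigma> \<in> Sigma_seqs' d"
  shows "eventually (\<lambda>n. \<sigma> \<in> words' d n) sequentially"
  using eventually_in_words[of d \<sigma>] assms by (simp add: words'_iff Sigma_seqs'_def)

lemma words_0: "d > 0 \<Longrightarrow> words d 0 = {(\<lambda>k. 0)(0 := undefined)}"
  by (auto simp: words_iff fun_eq_iff)

text \<open>Appending a digit, possibly 0, is one more inverse step at the far end of a backward
  orbit.\<close>

lemma bij_betw_words_Suc:
  assumes "d > 0"
  shows "bij_betw (\<lambda>(\<sigma>, i). \<sigma>(Suc n := i)) (words d n \<times> {..<d}) (words d (Suc n))"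
proof (rule bij_betw_byWitness[of _ "\<lambda>\<tau>. (\<tau>(Suc n := 0), \<tau> (Suc n))"])
  show "(\<lambda>(\<sigma>, i). \<sigma>(Suc n := i)) ` (words d n \<times> {..<d}) \<subseteq> words d (Suc n)"
    using assms by (auto simp: words_iff)
  show "(\<lambda>\<tau>. (\<tau>(Suc n := 0), \<tau> (Suc n))) ` words d (Suc n) \<subseteq> words d n \<times> {..<d}"
    using assms by (auto simp: words_iff)
qed (use assms in \<open>auto simp: words_iff fun_eq_iff\<close>)

text \<open>Prepending a nonzero digit \<open>i\<close> turns the orbit of \<open>B i b\<close> into
  one of \<open>b\<close>.\<close>

lemma bij_betw_words'_Suc:
  assumes "d > 0"
  shows "bij_betw (\<lambda>(i, \<sigma>). word_Cons i \<sigma>) ({1..<d} \<times> words d n) (words' d (Suc n))"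
proof (rule bij_betw_byWitness[of _ "\<lambda>\<tau>. (\<tau> 1, (\<lambda>k. \<tau> (Suc k))(0 := undefined))"])
  show "(\<lambda>(i, \<sigma>). word_Cons i \<sigma>) ` ({1..<d} \<times> words d n) \<subseteq> words' d (Suc n)"
    using assms by (auto simp: words'_iff words_iff word_Cons_def)
  show "(\<lambda>\<tau>. (\<tau> 1, (\<lambda>k. \<tau> (Suc k))(0 := undefined))) ` words' d (Suc n) \<subseteq> {1..<d} \<times> words d n"
    using assms by (auto simp: words'_iff words_iff)
qed (use assms in \<open>auto simp: words'_iff words_iff word_Cons_def fun_eq_iff\<close>)

section \<open>Counting words, and products and sums over them\<close>

lemma card_words:
  assumes "d > 0"
  shows "finite (words d n)" "card (words d n) = d ^ n"
proof -
  have "finite (words d n) \<and> card (words d n) = d ^ n"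
  proof (induction n)
    case (Suc n)
    then show ?case
      using bij_betw_finite[OF bij_betw_words_Suc[OF assms, of n]]
        bij_betw_same_card[OF bij_betw_words_Suc[OF assms, of n]]
      by (simp add: card_cartesian_product mult.commute)
  qed (simp add: words_0 assms)
  then show "finite (words d n)" "card (words d n) = d ^ n"
    by auto
qed

lemma finite_words': "d > 0 \<Longrightarrow> finite (words' d n)"
  using card_words(1) by (rule rev_finite_subset) (auto simp: words'_iff)

lemma prod_words_Suc:
  assumes "d > 0"
  shows "prod F (words d (Suc n)) = (\<Prod>\<sigma>\<in>words d n. \<Prod>i<d. F (\<sigma>(Suc n := i)))"
  using prod.reindex_bij_betw[OF bij_betw_words_Suc[OF assms], of F n]
  by (simp add: prod.cartesian_product case_prod_unfold)

lemma prod_words'_Suc: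
  assumes "d > 0"
  shows "prod F (words' d (Suc n)) = (\<Prod>i\<in>{1..<d}. \<Prod>\<sigma>\<in>words d n. F (word_Cons i \<sigma>))"
  using prod.reindex_bij_betw[OF bij_betw_words'_Suc[OF assms], of F n]
  by (simp add: prod.cartesian_product case_prod_unfold)

text \<open>
  There are at most \<open>d ^ l\<close> sequences of length \<open>l\<close>, so the sum is dominated by a geometric
  series of ratio \<open>d / A\<close>.
\<close>

lemma summable_on_Sigma_seqs:
  fixes A :: real
  assumes d: "d > 0" and A: "real d < A"
  shows "(\<lambda>\<sigma>. (1 / A) ^ word_length \<sigma>) summable_on Sigma_seqs d"
proof (rule nonneg_bdd_above_summable_on)
  have A0: "A > 0"
    using A of_nat_0_le_iff[of d] by linarith
  then show "0 \<le> (1 / A) ^ word_length \<sigma>" for \<sigma> by simp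
  define q where "q = real d / A"
  have q: "0 \<le> q" "q < 1"
    using A A0 by (auto simp: q_def)
  show "bdd_above (sum (\<lambda>\<sigma>. (1 / A) ^ word_length \<sigma>) ` {F. F \<subseteq> Sigma_seqs d \<and> finite F})"
  proof (rule bdd_aboveI2)
    fix F assume "F \<in> {F. F \<subseteq> Sigma_seqs d \<and> finite F}"
    then have F: "F \<subseteq> Sigma_seqs d" "finite F" by auto
    \<comment> \<open>The inserted 0 covers an empty \<open>F\<close>.\<close>
    define n where "n = Max (insert 0 (word_length ` F))"
    have n: "word_length \<sigma> \<le> n" if "\<sigma> \<in> F" for \<sigma>
      unfolding n_def using F that by (intro Max_ge) auto
    then have Fw: "F \<subseteq> words d n"
      using F d words_word_length by blast
    have "(\<Sum>\<sigma>\<in>F. (1 / A) ^ word_length \<sigma>) \<le> (\<Sum>\<sigma>\<in>words d n. (1 / A) ^ word_length \<sigma>)"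
      using Fw A0 d by (intro sum_mono2 card_words) auto
    \<comment> \<open>Each sequence is counted for every \<open>l\<close> from its length up to
      \<open>n\<close>. This overcount only enlarges the sum, and it lets the count
      \<open>d ^ l\<close> of \<open>words d l\<close> be used instead of the number of sequences of
      exact length \<open>l\<close>.\<close>
    also have "\<dots> \<le> (\<Sum>\<sigma>\<in>words d n. \<Sum>l\<le>n. if \<sigma> \<in> words d l then (1 / A) ^ l else 0)"
    proof (rule sum_mono)
      fix \<sigma> assume s: "\<sigma> \<in> words d n"
      then have S: "\<sigma> \<in> Sigma_seqs d" "\<sigma> \<in> words d (word_length \<sigma>)" "word_length \<sigma> \<le> n"
        using words_subset words_word_length[OF d] by blast+
      have "(if \<sigma> \<in> words d (word_length \<sigma>) then (1 / A) ^ word_length \<sigma> else 0)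
          \<le> (\<Sum>l\<le>n. if \<sigma> \<in> words d l then (1 / A) ^ l else 0)"
        using S A0 by (intro member_le_sum) auto
      then show "(1 / A) ^ word_length \<sigma> \<le> (\<Sum>l\<le>n. if \<sigma> \<in> words d l then (1 / A) ^ l else 0)"
        using S by simp
    qed
    also have "\<dots> = (\<Sum>l\<le>n. \<Sum>\<sigma>\<in>words d n. if \<sigma> \<in> words d l then (1 / A) ^ l else 0)"
      by (rule sum.swap)
    also have "\<dots> \<le> (\<Sum>l\<le>n. q ^ l)"
    proof (rule sum_mono)
      fix l
      have "(\<Sum>\<sigma>\<in>words d n. if \<sigma> \<in> words d l then (1 / A) ^ l else 0)
          = real (card (words d n \<inter> words d l)) * (1 / A) ^ l"
        using card_words[OF d] by (simp flip: sum.inter_restrict)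
      also have "\<dots> \<le> real (card (words d l)) * (1 / A) ^ l"
        using A0 by (intro mult_right_mono of_nat_mono card_mono card_words d) auto
      also have "\<dots> = q ^ l"
        by (simp add: card_words[OF d] q_def power_divide)
      finally show "(\<Sum>\<sigma>\<in>words d n. if \<sigma> \<in> words d l then (1 / A) ^ l else 0) \<le> q ^ l" .
    qed
    also have "\<dots> \<le> (\<Sum>l. q ^ l)"
      using q by (intro sum_le_suminf) (auto simp: summable_geometric)
    finally show "(\<Sum>\<sigma>\<in>F. (1 / A) ^ word_length \<sigma>) \<le> (\<Sum>l. q ^ l)" .
  qed
qed

section \<open>Backward orbits along digit sequences\<close>

lemma backorbit_cong:
  assumes "\<And>k. 1 \<le> k \<Longrightarrow> k \<le> n \<Longrightarrow> \<sigma> k = \<tau> k"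
  shows "backorbit B \<sigma> n w = backorbit B \<tau> n w"
  using assms by (induction n) auto

lemma backorbit_word_Cons:
  "backorbit B (word_Cons i \<sigma>) (Suc n) w = backorbit B \<sigma> n (B i w)"
  by (induction n) (simp_all add: word_Cons_def)

lemma backorbit_trailing_zeros:
  assumes "\<And>k. k > l \<Longrightarrow> \<sigma> k = 0"
  shows "backorbit B \<sigma> (l + n) w = (B 0 ^^ n) (backorbit B \<sigma> l w)"
  using assms by (induction n) auto

subsection \<open>Inverse branches\<close>

locale poincare_function =
  fixes P :: "complex poly" and a b :: complex and f :: "complex \<Rightarrow> complex"
    and B :: "nat \<Rightarrow> complex \<Rightarrow> complex"
  assumes deg: "degree P \<ge> 2"
    and fixed: "poly P b = b"
    and multiplier: "a = poly (pderiv P) b"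
    and repelling: "norm a > 1"
    and entire: "f holomorphic_on UNIV"
    and poincare: "\<And>z. f (a * z) = poly P (f z)"
    and f_0: "f 0 = b"
    and f'_0: "deriv f 0 = 1"
    and branches: "inverse_branches P b B"
    and hypothesis1: "\<And>w. (\<lambda>n. (B 0 ^^ n) w) \<longlonglongrightarrow> b"
    and deg_less: "real (degree P) < norm a"
begin

abbreviation d :: nat where "d \<equiv> degree P"

abbreviation Q :: "complex poly" where "Q \<equiv> Qpoly P b"

abbreviation orb :: "(nat \<Rightarrow> nat) \<Rightarrow> nat \<Rightarrow> complex \<Rightarrow> complex" where
  "orb \<equiv> backorbit B"

lemma d_pos: "d > 0"
  using deg by simp

lemma a_nonzero: "a \<noteq> 0"
  using repelling by auto

lemma B_0_b: "B 0 b = b"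
  using branches by (simp add: inverse_branches_def)

text \<open>The branches list the roots with multiplicity, and subtracting a constant from a
  nonconstant polynomial keeps its leading coefficient.\<close>

lemma P_minus_const_factor: "P - [:w:] = smult (lead_coeff P) (\<Prod>i<d. [:- B i w, 1:])"
proof -
  have "degree (P + (- [:w:])) = d"
    by (rule degree_add_eq_left) (use deg in simp)
  then have "degree (P - [:w:]) = d"
    by (simp only: diff_conv_add_uminus)
  moreover have "coeff (P - [:w:]) d = lead_coeff P"
    using deg by (simp add: coeff_pCons split: nat.split)
  ultimately have lc: "lead_coeff (P - [:w:]) = lead_coeff P"
    by simp
  have "proots (P - [:w:]) = image_mset (\<lambda>i. B i w) (mset_set {..<d})"
    using branches by (simp add: inverse_branches_def)
  then show ?thesis
    using complex_poly_decompose_multiset[of "P - [:w:]"] unfolding lc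
    by (simp add: image_mset.compositionality o_def prod_unfold_prod_mset)
qed

lemma poly_P_minus: "poly P y - w = lead_coeff P * (\<Prod>i<d. y - B i w)"
  using arg_cong[OF P_minus_const_factor[of w], of "\<lambda>p. poly p y"] by (simp add: poly_prod)

lemma P_B:
  assumes "i < d"
  shows "poly P (B i w) = w"
proof -
  have "(\<Prod>j<d. B i w - B j w) = 0"
    by (rule prod_zero) (use assms in auto)
  then show ?thesis
    using poly_P_minus[of "B i w" w] by (simp only:) simp
qed

lemma P_minus_b_factor: "P - [:b:] = [:- b, 1:] * smult (lead_coeff P) (\<Prod>i\<in>{1..<d}. [:- B i b, 1:])"
proof -
  have "{..<d} = insert 0 {1..<d}"
    using d_pos by auto
  then show ?thesis
    unfolding P_minus_const_factor by (simp add: B_0_b)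
qed

text \<open>\<open>B 0 b = b\<close> supplies the linear factor at \<open>b\<close>, so the division
  defining \<open>Qpoly\<close> is exact and the other branches at \<open>b\<close> remain as its
  roots.\<close>

lemma Q_factor: "Q = smult (lead_coeff P) (\<Prod>i\<in>{1..<d}. [:- B i b, 1:])"
  unfolding Qpoly_def P_minus_b_factor by (rule nonzero_mult_div_cancel_left) simp

lemma poly_P_minus_b: "poly P y - b = (y - b) * poly Q y"
  using arg_cong[OF P_minus_b_factor, folded Q_factor, of "\<lambda>p. poly p y"]
  by (simp add: algebra_simps)

lemma poly_Q_b: "poly Q b = a"
proof -
  have "pderiv P = pderiv (P - [:b:])"
    by (simp add: pderiv_diff pderiv_pCons)
  also have "\<dots> = pderiv ([:- b, 1:] * Q)"
    unfolding Q_factor P_minus_b_factor ..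
  finally have "a = poly (pderiv ([:- b, 1:] * Q)) b"
    unfolding multiplier by (rule arg_cong)
  also have "\<dots> = poly Q b"
    by (simp only: pderiv_mult) (simp add: pderiv_pCons)
  finally show ?thesis ..
qed

lemma poly_Q: "poly Q y = lead_coeff P * (\<Prod>i\<in>{1..<d}. y - B i b)"
  unfolding Q_factor by (simp add: poly_prod)

text \<open>Since \<open>Q\<close> takes the value \<open>a \<noteq> 0\<close> at \<open>b\<close>,
  the root \<open>b\<close> of \<open>P - b\<close> is simple, and \<open>B 0\<close> already
  accounts for it.\<close>

lemma B_b_neq:
  assumes "i \<in> {1..<d}"
  shows "B i b \<noteq> b"
proof
  assume "B i b = b"
  then have "(\<Prod>j\<in>{1..<d}. b - B j b) = 0"
    by (intro prod_zero) (use assms in \<open>auto intro!: bexI[of _ i]\<close>)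
  then show False
    using poly_Q[of b] poly_Q_b a_nonzero by (simp only:) simp
qed

lemma poly_Q_eq_prod: "poly Q y = a * (\<Prod>i\<in>{1..<d}. (y - B i b) / (b - B i b))"
proof -
  have "(\<Prod>i\<in>{1..<d}. b - B i b) \<noteq> 0"
    unfolding prod_zero_iff[OF finite_atLeastLessThan] using B_b_neq by force
  then show ?thesis
    using poly_Q[of b] poly_Q[of y] by (simp add: poly_Q_b prod_dividef)
qed

text \<open>Dividing by the value at \<open>y = b\<close>, which is \<open>b - w\<close> as
  \<open>b\<close> is fixed, cancels the leading coefficient. Each factor on the right is again such
  a normalized quotient, ready for the next iteration.\<close>

lemma P_quotient: "w \<noteq> b \<Longrightarrow> (poly P y - w) / (b - w) = (\<Prod>i<d. (y - B i w) / (b - B i w))"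
  using poly_P_minus[of y w] poly_P_minus[of b w] deg by (auto simp: fixed prod_dividef)

section \<open>Forward iteration along backward orbits\<close>

lemma Sigma_seqs_less: "\<sigma> \<in> Sigma_seqs d \<Longrightarrow> k \<ge> 1 \<Longrightarrow> \<sigma> k < d"
  by (simp add: Sigma_seqs_iff[OF d_pos])

lemma P_orb: "\<sigma> \<in> Sigma_seqs d \<Longrightarrow> poly P (orb \<sigma> (Suc n) w) = orb \<sigma> n w"
  by (simp add: P_B Sigma_seqs_less)

lemma P_iter_orb:
  assumes "\<sigma> \<in> Sigma_seqs d"
  shows "(poly P ^^ k) (orb \<sigma> (n + k) w) = orb \<sigma> n w"
proof (induction k)
  case (Suc k)
  have "(poly P ^^ Suc k) (orb \<sigma> (n + Suc k) w) = (poly P ^^ k) (poly P (orb \<sigma> (Suc (n + k)) w))"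
    by (simp only: funpow_Suc_right o_apply add_Suc_right)
  then show ?case
    using Suc P_orb[OF assms, of "n + k" w] by simp
qed simp

lemma P_iter_b: "(poly P ^^ k) b = b"
  by (induction k) (simp_all add: fixed)

text \<open>Iterates of \<open>P\<close> fix \<open>b\<close> and carry the later orbit points back
  to \<open>orb \<sigma> m w\<close>.\<close>

lemma orb_neq_b:
  assumes "\<sigma> \<in> Sigma_seqs d" "m \<le> n" "orb \<sigma> m w \<noteq> b"
  shows "orb \<sigma> n w \<noteq> b"
  using P_iter_orb[OF assms(1), of "n - m" m w] assms(2,3) P_iter_b by auto

text \<open>Induction at \<open>P y\<close> in place of \<open>y\<close>; \<open>P_quotient\<close>
  then splits the factor of each word into those of its \<open>d\<close> extensions.\<close>

lemma P_iter_quotient: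
  assumes "w \<noteq> b"
  shows "((poly P ^^ n) y - w) / (b - w) = (\<Prod>\<sigma>\<in>words d n. (y - orb \<sigma> n w) / (b - orb \<sigma> n w))"
proof (induction n arbitrary: y)
  case (Suc n)
  have "((poly P ^^ Suc n) y - w) / (b - w)
      = (\<Prod>\<sigma>\<in>words d n. (poly P y - orb \<sigma> n w) / (b - orb \<sigma> n w))"
    using Suc[of "poly P y"] by (simp add: funpow_Suc_right del: funpow.simps)
  also have "\<dots> = (\<Prod>\<sigma>\<in>words d n. \<Prod>i<d. (y - B i (orb \<sigma> n w)) / (b - B i (orb \<sigma> n w)))"
    using orb_neq_b[of _ 0 n w] assms words_subset by (intro prod.cong P_quotient) auto
  also have "\<dots> = (\<Prod>\<sigma>\<in>words d n. \<Prod>i<d.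
      (y - orb (\<sigma>(Suc n := i)) (Suc n) w) / (b - orb (\<sigma>(Suc n := i)) (Suc n) w))"
  proof (intro prod.cong refl)
    fix \<sigma> i
    have "orb (\<sigma>(Suc n := i)) n w = orb \<sigma> n w"
      by (rule backorbit_cong) auto
    then show "(y - B i (orb \<sigma> n w)) / (b - B i (orb \<sigma> n w))
        = (y - orb (\<sigma>(Suc n := i)) (Suc n) w) / (b - orb (\<sigma>(Suc n := i)) (Suc n) w)"
      by simp
  qed
  finally show ?case
    by (simp only: prod_words_Suc[OF d_pos])
qed (use assms in \<open>simp add: words_0[OF d_pos]\<close>)

text \<open>
  Near \<open>b\<close> the polynomial \<open>P\<close> is injective and \<open>B 0\<close> is continuous, so a second branch value near \<open>b\<close>
  would coincide with that of \<open>B 0\<close> and be a critical point.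
\<close>

lemma nonprincipal_branches_separated:
  obtains \<delta> where "\<delta> > 0" "\<And>u i. i \<in> {1..<d} \<Longrightarrow> \<delta> \<le> norm (B i u - b)"
proof -
  have hol: "poly P holomorphic_on UNIV"
    by (intro holomorphic_intros)
  have deriv: "deriv (poly P) y = poly (pderiv P) y" for y
    by (intro DERIV_imp_deriv poly_DERIV)
  obtain r where r: "r > 0" "inj_on (poly P) (ball b r)"
    using has_complex_derivative_locally_injective[OF hol, of b] a_nonzero
    unfolding deriv multiplier by auto
  obtain U where U: "open U" "b \<in> U" "B 0 analytic_on U"
    using branches by (auto simp: inverse_branches_def)
  then have "isCont (B 0) b"
    by (metis analytic_at_imp_isCont analytic_on_analytic_at)
  then obtain s where s: "s > 0" "\<And>u. dist u b < s \<Longrightarrow> dist (B 0 u) b < r"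
    using r(1) unfolding continuous_at_eps_delta B_0_b by blast
  have "isCont (poly P) b"
    by simp
  then obtain t where t: "t > 0" "\<And>y. dist y b < t \<Longrightarrow> dist (poly P y) b < s"
    using s(1) unfolding continuous_at_eps_delta fixed by blast
  \<comment> \<open>If \<open>B i u\<close> is within \<open>t\<close> of \<open>b\<close>, then its
    image \<open>u\<close> is within \<open>s\<close>, and so \<open>B 0 u\<close> is within
    \<open>r\<close>, where \<open>P\<close> is injective.\<close>
  have "min r t \<le> norm (B i u - b)" if i: "i \<in> {1..<d}" for u i
  proof (rule ccontr)
    assume "\<not> min r t \<le> norm (B i u - b)"
    then have near: "dist (B i u) b < r" "dist (B i u) b < t"
      by (auto simp: dist_norm)
    have "dist u b < s"
      using t(2)[OF near(2)] P_B[of i u] i by simp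
    then have "dist (B 0 u) b < r"
      by (rule s(2))
    moreover have "poly P (B 0 u) = poly P (B i u)"
      using P_B[of i u] P_B[of 0 u] i by simp
    ultimately have eq: "B 0 u = B i u"
      using near r(2) by (auto simp: inj_on_def dist_commute)
    define y where "y = B i u"
    define R where "R = smult (lead_coeff P) (\<Prod>j\<in>{..<d} - {0} - {i}. [:- B j u, 1:])"
    \<comment> \<open>Roots are listed with multiplicity, so two branches with equal values give a
      double root.\<close>
    have "P - [:u:] = [:- y, 1:] * ([:- y, 1:] * R)"
      unfolding P_minus_const_factor R_def y_def using i
      by (subst prod.remove[of _ 0], simp, simp, subst prod.remove[of _ i]) (auto simp: eq)
    then have "pderiv (P - [:u:]) = pderiv ([:- y, 1:] * ([:- y, 1:] * R))"
      by simp
    moreover have "pderiv (P - [:u:]) = pderiv P"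
      by (simp add: pderiv_diff pderiv_pCons)
    moreover have "poly (pderiv ([:- y, 1:] * ([:- y, 1:] * R))) y = 0"
      by (simp only: pderiv_mult) simp
    ultimately have "deriv (poly P) y = 0"
      unfolding deriv by simp
    moreover have "deriv (poly P) y \<noteq> 0"
      by (rule holomorphic_injective_imp_regular[of _ "ball b r"])
        (use r near in \<open>auto intro: holomorphic_on_subset[OF hol] simp: y_def dist_commute\<close>)
    ultimately show False
      by simp
  qed
  then show ?thesis
    using that[of "min r t"] r(1) t(1) by simp
qed

text \<open>This is \<open>hypothesis1\<close> at the point reached after the last nonzero
  digit.\<close>

lemma orb_tendsto:
  assumes "\<sigma> \<in> Sigma_seqs d"
  shows "(\<lambda>n. orb \<sigma> n w) \<longlonglongrightarrow> b"
proof -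
  have "orb \<sigma> (word_length \<sigma> + n) w = (B 0 ^^ n) (orb \<sigma> (word_length \<sigma>) w)" for n
    by (rule backorbit_trailing_zeros) (rule word_length_spec[OF d_pos assms])
  then have "(\<lambda>n. orb \<sigma> (n + word_length \<sigma>) w) \<longlonglongrightarrow> b"
    using hypothesis1[of "orb \<sigma> (word_length \<sigma>) w"] by (simp add: add.commute)
  then show ?thesis
    by (rule LIMSEQ_offset)
qed

subsection \<open>Backward orbits near the repelling fixed point\<close>

lemma f_iter: "f (a ^ n * z) = (poly P ^^ n) (f z)"
proof (induction n)
  case (Suc n)
  then show ?case
    using poincare[of "a ^ n * z"] by (simp add: mult.assoc)
qed simp

lemma f_scaling: "f z = (poly P ^^ n) (f (z / a ^ n))"
  using f_iter[of n "z / a ^ n"] a_nonzero by simp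

lemma f_has_derivative: "(f has_field_derivative 1) (at 0)"
  using holomorphic_derivI[OF entire, of 0] f'_0 by simp

text \<open>As the derivative at 0 is 1, the quotient \<open>(f \<xi> - b) / \<xi>\<close> is within
  1/2 of 1 near 0, whence both factors 2. The open mapping theorem supplies
  \<open>\<rho>\<close>.\<close>

lemma f_inverse_near_b:
  obtains r \<rho> where "r > 0" "\<rho> > 0" "inj_on f (ball 0 r)"
    "\<And>\<xi>. \<xi> \<in> ball 0 r \<Longrightarrow> norm (f \<xi> - b) \<le> 2 * norm \<xi>"
    "\<And>y. norm (y - b) < \<rho> \<Longrightarrow> \<exists>\<xi>\<in>ball 0 r. f \<xi> = y \<and> norm \<xi> \<le> 2 * norm (y - b)"
proof -
  obtain r1 where r1: "r1 > 0" "inj_on f (ball 0 r1)"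
    using has_complex_derivative_locally_injective[OF entire, of 0] f'_0 by auto
  have "(\<lambda>\<xi>. (f \<xi> - b) / \<xi>) \<midarrow>0\<rightarrow> 1"
    using f_has_derivative by (simp add: has_field_derivative_iff f_0)
  then obtain r2 where r2: "r2 > 0"
    "\<And>\<xi>. \<xi> \<noteq> 0 \<Longrightarrow> norm \<xi> < r2 \<Longrightarrow> norm ((f \<xi> - b) / \<xi> - 1) < 1 / 2"
    unfolding LIM_eq by (auto dest: spec[of _ "1 / 2"])
  define r where "r = min r1 r2"
  have r: "r > 0" "r \<le> r1" "r \<le> r2"
    using r1 r2 by (auto simp: r_def)
  have inj: "inj_on f (ball 0 r)"
    by (rule inj_on_subset[OF r1(2)]) (use r in auto)
  have bounds: "norm (f \<xi> - b) \<le> 2 * norm \<xi> \<and> norm \<xi> \<le> 2 * norm (f \<xi> - b)"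
    if "\<xi> \<in> ball 0 r" for \<xi>
  proof (cases "\<xi> = 0")
    case False
    define t where "t = (f \<xi> - b) / \<xi>"
    have "norm (t - 1) < 1 / 2"
      unfolding t_def using r2(2)[OF False] that r by simp
    then have "norm t \<le> 2" "1 \<le> 2 * norm t"
      using norm_triangle_ineq[of "t - 1" 1] norm_triangle_ineq2[of 1 t]
      by (simp_all add: norm_minus_commute)
    moreover have "norm (f \<xi> - b) = norm t * norm \<xi>"
      using False by (simp add: t_def norm_divide)
    ultimately show ?thesis
      using mult_right_mono[of "norm t" 2 "norm \<xi>"] mult_right_mono[of 1 "2 * norm t" "norm \<xi>"]
      by simp
  qed (simp add: f_0)
  have "open (f ` ball 0 r)"
    by (rule open_mapping_thm3[OF holomorphic_on_subset[OF entire]]) (use inj in auto)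
  moreover have "b \<in> f ` ball 0 r"
    using r(1) f_0 by (intro image_eqI[of _ _ 0]) auto
  ultimately obtain \<rho> where rho: "\<rho> > 0" "ball b \<rho> \<subseteq> f ` ball 0 r"
    by (meson openE)
  have "\<exists>\<xi>\<in>ball 0 r. f \<xi> = y \<and> norm \<xi> \<le> 2 * norm (y - b)" if "norm (y - b) < \<rho>" for y
  proof -
    have "y \<in> f ` ball 0 r"
      using rho(2) that by (auto simp: dist_norm norm_minus_commute)
    then show ?thesis
      using bounds by auto
  qed
  then show ?thesis
    using that[OF r(1) rho(1) inj] bounds by blast
qed

text \<open>
  A point whose orbit reaches distance \<open>\<delta>\<close> from \<open>b\<close> at time \<open>k\<close> is \<open>f \<xi>\<close> with \<open>f (a ^ k * \<xi>)\<close> at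
  distance at least \<open>\<delta>\<close>, which forces \<open>a ^ k * \<xi>\<close> to be bounded away from \<open>0\<close>.
\<close>

lemma escape_lower_bound:
  assumes "\<delta> > 0"
  obtains c where "c > 0"
    "\<And>k y. \<delta> \<le> norm ((poly P ^^ k) y - b) \<Longrightarrow> c \<le> norm a ^ k * norm (y - b)"
proof -
  obtain r \<rho> where r: "r > 0" and rho: "\<rho> > 0"
    and up: "\<And>\<xi>. \<xi> \<in> ball 0 r \<Longrightarrow> norm (f \<xi> - b) \<le> 2 * norm \<xi>"
    and inv: "\<And>y. norm (y - b) < \<rho> \<Longrightarrow> \<exists>\<xi>\<in>ball 0 r. f \<xi> = y \<and> norm \<xi> \<le> 2 * norm (y - b)"
    using f_inverse_near_b by metis
  \<comment> \<open>One entry per case: \<open>\<delta> / 4\<close> if \<open>a ^ k * \<xi>\<close>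
    stays in the ball (two factors 2 combine), \<open>r / 2\<close> if it leaves the ball, and
    \<open>\<rho>\<close> if \<open>y\<close> is already far from \<open>b\<close>.\<close>
  define c where "c = min (min (\<delta> / 4) (r / 2)) \<rho>"
  have "c \<le> norm a ^ k * norm (y - b)" if y: "\<delta> \<le> norm ((poly P ^^ k) y - b)" for k y
  proof (cases "norm (y - b) < \<rho>")
    case True
    then obtain \<xi> where xi: "f \<xi> = y" "norm \<xi> \<le> 2 * norm (y - b)"
      using inv by blast
    then have *: "norm (a ^ k * \<xi>) \<le> 2 * (norm a ^ k * norm (y - b))"
      using mult_left_mono[OF xi(2), of "norm a ^ k"] by (simp add: norm_mult norm_power)
    show ?thesis
    proof (cases "a ^ k * \<xi> \<in> ball 0 r")
      case True
      then show ?thesis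
        using up[OF True] * y xi(1) by (simp add: f_iter c_def)
    next
      case False
      then have "r \<le> norm (a ^ k * \<xi>)"
        by simp
      then show ?thesis
        using * unfolding c_def by linarith
    qed
  next
    case False
    have "1 * norm (y - b) \<le> norm a ^ k * norm (y - b)"
      using repelling by (intro mult_right_mono one_le_power) auto
    then show ?thesis
      using False unfolding c_def by linarith
  qed
  moreover have "c > 0"
    using assms r rho by (simp add: c_def)
  ultimately show ?thesis
    using that by blast
qed

text \<open>This is \<open>x\<close> times the difference quotient of \<open>f\<close> at 0 along
  \<open>x / a ^ n\<close>; for \<open>x = 0\<close> the sequence is constantly 0.\<close>

lemma f_scaled_tendsto: "(\<lambda>n. a ^ n * (f (x / a ^ n) - b)) \<longlonglongrightarrow> x"
proof (cases "x = 0")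
  case False
  have "(\<lambda>n. (1 / a) ^ n) \<longlonglongrightarrow> 0"
    using repelling by (intro LIMSEQ_power_zero) (simp add: norm_divide divide_less_eq_1)
  from tendsto_mult[OF tendsto_const this, of x] have "(\<lambda>n. x / a ^ n) \<longlonglongrightarrow> 0"
    by (simp add: power_divide)
  then have "filterlim (\<lambda>n. x / a ^ n) (at 0) sequentially"
    using False a_nonzero by (simp add: filterlim_at)
  moreover have "(\<lambda>\<xi>. (f \<xi> - b) / \<xi>) \<midarrow>0\<rightarrow> 1"
    using f_has_derivative by (simp add: has_field_derivative_iff f_0)
  ultimately have "(\<lambda>n. (f (x / a ^ n) - b) / (x / a ^ n)) \<longlonglongrightarrow> 1"
    by (rule filterlim_compose[rotated])
  then have "(\<lambda>n. x * ((f (x / a ^ n) - b) / (x / a ^ n))) \<longlonglongrightarrow> x * 1"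
    by (intro tendsto_mult tendsto_const)
  then show ?thesis
    using False by (simp add: mult.commute)
qed (simp add: f_0)

text \<open>The linearizing coordinate at \<open>b\<close>, transported along the backward orbit:
  \<open>G \<sigma> w\<close> is the \<open>w\<close>-point of \<open>f\<close> selected by
  \<open>\<sigma>\<close>. It treats \<open>g_sigma\<close> and \<open>a * g_sigma0\<close>
  together.\<close>

definition G :: "(nat \<Rightarrow> nat) \<Rightarrow> complex \<Rightarrow> complex" where
  "G \<sigma> w = lim (\<lambda>n. a ^ n * (orb \<sigma> n w - b))"

text \<open>
  Close to \<open>b\<close> the orbit lifts under \<open>f\<close> to a sequence \<open>\<xi> n\<close> with \<open>a * \<xi> (n + 1) = \<xi> n\<close>.
\<close>

lemma G_limit:
  assumes \<sigma>: "\<sigma> \<in> Sigma_seqs d" and neq: "orb \<sigma> m w \<noteq> b"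
  shows "(\<lambda>n. a ^ n * (orb \<sigma> n w - b)) \<longlonglongrightarrow> G \<sigma> w" and "G \<sigma> w \<noteq> 0"
proof -
  obtain r \<rho> where r: "r > 0" and rho: "\<rho> > 0" and inj: "inj_on f (ball 0 r)"
    and inv: "\<And>y. norm (y - b) < \<rho> \<Longrightarrow> \<exists>\<xi>\<in>ball 0 r. f \<xi> = y \<and> norm \<xi> \<le> 2 * norm (y - b)"
    using f_inverse_near_b by metis
  \<comment> \<open>\<open>\<rho>\<close> makes the lift exist; \<open>r / (2 * norm a)\<close>
    keeps \<open>a * \<xi>\<close> too in the ball where \<open>f\<close> is injective.\<close>
  define e where "e = min \<rho> (r / (2 * norm a))"
  have e: "e > 0"
    using r rho a_nonzero by (simp add: e_def)
  obtain N0 where N0: "\<And>n. n \<ge> N0 \<Longrightarrow> dist (orb \<sigma> n w) b < e"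
    using metric_LIMSEQ_D[OF orb_tendsto[OF \<sigma>] e] by blast
  \<comment> \<open>From index \<open>m\<close> on the orbit avoids \<open>b\<close>, which makes
    the lift \<open>\<xi> 0\<close> nonzero.\<close>
  define N where "N = max m N0"
  have "\<exists>\<xi>\<in>ball 0 r. f \<xi> = orb \<sigma> (N + k) w \<and> a * \<xi> \<in> ball 0 r" for k
  proof -
    have d: "norm (orb \<sigma> (N + k) w - b) < e"
      using N0[of "N + k"] by (simp add: N_def dist_norm)
    then obtain \<xi> where xi: "\<xi> \<in> ball 0 r" "f \<xi> = orb \<sigma> (N + k) w"
      "norm \<xi> \<le> 2 * norm (orb \<sigma> (N + k) w - b)"
      using inv unfolding e_def by force
    have "norm \<xi> < 2 * (r / (2 * norm a))"
      using xi(3) d unfolding e_def by linarith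
    then have "norm (a * \<xi>) < r"
      using a_nonzero by (simp add: norm_mult field_simps)
    then show ?thesis
      using xi by auto
  qed
  then obtain \<xi> where xi: "\<And>k. \<xi> k \<in> ball 0 r" "\<And>k. f (\<xi> k) = orb \<sigma> (N + k) w"
    "\<And>k. a * \<xi> k \<in> ball 0 r"
    by metis
  have "a * \<xi> (Suc k) = \<xi> k" for k
  proof (rule inj_onD[OF inj])
    show "f (a * \<xi> (Suc k)) = f (\<xi> k)"
      using P_orb[OF \<sigma>, of "N + k" w] by (simp add: poincare xi)
  qed (use xi in auto)
  then have step: "\<xi> (Suc k) = \<xi> k / a" for k
    using a_nonzero by (metis nonzero_mult_div_cancel_left)
  have lift: "\<xi> k = \<xi> 0 / a ^ k" for k
    by (induction k) (simp_all add: step)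
  have "(\<lambda>k. a ^ N * (a ^ k * (f (\<xi> 0 / a ^ k) - b))) \<longlonglongrightarrow> a ^ N * \<xi> 0"
    by (intro tendsto_mult tendsto_const f_scaled_tendsto)
  moreover have "a ^ N * (a ^ k * (f (\<xi> 0 / a ^ k) - b)) = a ^ (k + N) * (orb \<sigma> (k + N) w - b)" for k
    using xi(2)[of k] by (simp add: lift[symmetric] power_add add.commute)
  ultimately have "(\<lambda>k. a ^ (k + N) * (orb \<sigma> (k + N) w - b)) \<longlonglongrightarrow> a ^ N * \<xi> 0"
    by simp
  then have lim: "(\<lambda>n. a ^ n * (orb \<sigma> n w - b)) \<longlonglongrightarrow> a ^ N * \<xi> 0"
    by (rule LIMSEQ_offset)
  then have G: "G \<sigma> w = a ^ N * \<xi> 0"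
    unfolding G_def by (rule limI)
  with lim show "(\<lambda>n. a ^ n * (orb \<sigma> n w - b)) \<longlonglongrightarrow> G \<sigma> w"
    by simp
  have "orb \<sigma> N w \<noteq> b"
    by (rule orb_neq_b[OF \<sigma> _ neq]) (simp add: N_def)
  then have "\<xi> 0 \<noteq> 0"
    using xi(2)[of 0] f_0 by auto
  then show "G \<sigma> w \<noteq> 0"
    using G a_nonzero by simp
qed

text \<open>Prepending a digit delays the orbit by one step, which costs one power of
  \<open>a\<close>.\<close>

lemma G_word_Cons:
  assumes "\<sigma> \<in> Sigma_seqs d" "B i b \<noteq> b" "i < d"
  shows "G (word_Cons i \<sigma>) b = a * G \<sigma> (B i b)"
proof -
  have "(\<lambda>n. a * (a ^ n * (orb \<sigma> n (B i b) - b))) \<longlonglongrightarrow> a * G \<sigma> (B i b)"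
    using assms by (intro tendsto_mult tendsto_const G_limit[of _ 0]) auto
  then have "(\<lambda>n. a ^ Suc n * (orb (word_Cons i \<sigma>) (Suc n) b - b)) \<longlonglongrightarrow> a * G \<sigma> (B i b)"
    by (simp only: backorbit_word_Cons power_Suc mult.assoc)
  then have "(\<lambda>n. a ^ n * (orb (word_Cons i \<sigma>) n b - b)) \<longlonglongrightarrow> a * G \<sigma> (B i b)"
    by (simp only: filterlim_sequentially_Suc[of "\<lambda>n. a ^ n * (orb (word_Cons i \<sigma>) n b - b)"])
  then show ?thesis
    unfolding G_def by (rule limI)
qed

section \<open>Lower bounds for scaled orbits, and summability\<close>

lemma orb_1_neq_b:
  assumes "\<sigma> \<in> Sigma_seqs' d"
  shows "orb \<sigma> 1 b \<noteq> b"
  using assms B_b_neq[of "\<sigma> 1"] Sigma_seqs_less[of \<sigma> 1] by (simp add: Sigma_seqs'_def)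

text \<open>The constant does not depend on \<open>n\<close>, as domination requires. Right after
  its last nonzero digit the orbit is away from \<open>b\<close>; without such a digit the start
  \<open>w\<close> itself has to be.\<close>

lemma scaled_orb_lower_bound:
  assumes "\<eta> > 0"
  obtains c where "c > 0"
    "\<And>\<sigma> n w. \<sigma> \<in> words d n \<Longrightarrow> \<eta> \<le> norm (w - b) \<or> \<sigma> \<in> Sigma_seqs' d \<Longrightarrow>
       c * norm a ^ word_length \<sigma> \<le> norm (a ^ n * (orb \<sigma> n w - b))"
proof -
  obtain \<delta> where delta: "\<delta> > 0" "\<And>u i. i \<in> {1..<d} \<Longrightarrow> \<delta> \<le> norm (B i u - b)"
    using nonprincipal_branches_separated by blast
  obtain c where c: "c > 0"
    "\<And>k y. min \<delta> \<eta> \<le> norm ((poly P ^^ k) y - b) \<Longrightarrow> c \<le> norm a ^ k * norm (y - b)"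
    using escape_lower_bound[of "min \<delta> \<eta>"] delta(1) assms by auto
  have "c * norm a ^ word_length \<sigma> \<le> norm (a ^ n * (orb \<sigma> n w - b))"
    if s: "\<sigma> \<in> words d n" and w: "\<eta> \<le> norm (w - b) \<or> \<sigma> \<in> Sigma_seqs' d" for \<sigma> n w
  proof -
    have \<sigma>: "\<sigma> \<in> Sigma_seqs d"
      using s words_subset by blast
    define l where "l = word_length \<sigma>"
    have l: "l \<le> n"
      using s words_word_length[OF d_pos \<sigma>] by (simp add: l_def)
    have "min \<delta> \<eta> \<le> norm (orb \<sigma> l w - b)"
    proof (cases l)
      case 0
      \<comment> \<open>This rules out \<open>Sigma_seqs' d\<close> and leaves the alternative on
        \<open>w\<close>.\<close>
      then have "\<sigma> 1 = 0"
        using word_length_spec[OF d_pos \<sigma>, of 1] by (simp add: l_def)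
      then show ?thesis
        using w 0 by (simp add: Sigma_seqs'_def)
    next
      case (Suc l')
      then have "\<sigma> (Suc l') \<noteq> 0"
        using last_digit_nonzero[OF d_pos \<sigma>] by (simp add: l_def)
      then have "\<sigma> (Suc l') \<in> {1..<d}"
        using Sigma_seqs_less[OF \<sigma>, of "Suc l'"] by simp
      then show ?thesis
        using delta(2)[of "\<sigma> (Suc l')" "orb \<sigma> l' w"] Suc by simp
    qed
    then have "c \<le> norm a ^ (n - l) * norm (orb \<sigma> n w - b)"
      using P_iter_orb[OF \<sigma>, of "n - l" l w] l by (intro c(2)) simp
    then have "c * norm a ^ l \<le> norm a ^ (n - l) * norm (orb \<sigma> n w - b) * norm a ^ l"
      by (rule mult_right_mono) simp
    also have "\<dots> = norm a ^ (n - l + l) * norm (orb \<sigma> n w - b)"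
      by (simp add: power_add mult_ac)
    also have "\<dots> = norm (a ^ n * (orb \<sigma> n w - b))"
      using l by (simp add: norm_mult norm_power)
    finally show ?thesis
      unfolding l_def .
  qed
  then show ?thesis
    using that c(1) by blast
qed

text \<open>Let \<open>n\<close> tend to infinity: each \<open>\<sigma>\<close> lies in
  \<open>words d n\<close> for all large \<open>n\<close>.\<close>

lemma G_lower_bound:
  assumes "\<eta> > 0"
  obtains c where "c > 0"
    "\<And>\<sigma> w. \<sigma> \<in> Sigma_seqs d \<Longrightarrow> \<eta> \<le> norm (w - b) \<or> \<sigma> \<in> Sigma_seqs' d \<and> w = b \<Longrightarrow>
       c * norm a ^ word_length \<sigma> \<le> norm (G \<sigma> w)"
proof -
  obtain c where c: "c > 0"
    "\<And>\<sigma> n w. \<sigma> \<in> words d n \<Longrightarrow> \<eta> \<le> norm (w - b) \<or> \<sigma> \<in> Sigma_seqs' d \<Longrightarrow>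
       c * norm a ^ word_length \<sigma> \<le> norm (a ^ n * (orb \<sigma> n w - b))"
    using scaled_orb_lower_bound[OF assms] by blast
  have "c * norm a ^ word_length \<sigma> \<le> norm (G \<sigma> w)"
    if \<sigma>: "\<sigma> \<in> Sigma_seqs d" and w: "\<eta> \<le> norm (w - b) \<or> \<sigma> \<in> Sigma_seqs' d \<and> w = b" for \<sigma> w
  proof -
    have "orb \<sigma> 0 w \<noteq> b \<or> orb \<sigma> 1 w \<noteq> b"
      using w orb_1_neq_b assms by auto
    then have "(\<lambda>n. norm (a ^ n * (orb \<sigma> n w - b))) \<longlonglongrightarrow> norm (G \<sigma> w)"
      using G_limit(1)[OF \<sigma>] by (intro tendsto_norm) blast
    moreover have "eventually (\<lambda>n. c * norm a ^ word_length \<sigma> \<le> norm (a ^ n * (orb \<sigma> n w - b))) sequentially"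
      using eventually_in_words[OF d_pos \<sigma>] by eventually_elim (use c(2) w in blast)
    ultimately show ?thesis
      by (rule tendsto_lowerbound) simp
  qed
  then show ?thesis
    using that c(1) by blast
qed

lemma summable_on_inverse_G:
  assumes "w \<noteq> b"
  shows "(\<lambda>\<sigma>. norm (1 / G \<sigma> w)) summable_on Sigma_seqs d"
    and "(\<lambda>\<sigma>. norm (1 / G \<sigma> b)) summable_on Sigma_seqs' d"
proof -
  have eta: "norm (w - b) > 0"
    using assms by simp
  obtain c where c: "c > 0"
    "\<And>\<sigma> v. \<sigma> \<in> Sigma_seqs d \<Longrightarrow> norm (w - b) \<le> norm (v - b) \<or> \<sigma> \<in> Sigma_seqs' d \<and> v = b \<Longrightarrow>
       c * norm a ^ word_length \<sigma> \<le> norm (G \<sigma> v)"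
    using G_lower_bound[OF eta] by blast
  have M: "(\<lambda>\<sigma>. 1 / c * (1 / norm a) ^ word_length \<sigma>) summable_on Sigma_seqs d"
    by (intro summable_on_cmult_right summable_on_Sigma_seqs d_pos deg_less)
  have le: "norm (1 / G \<sigma> v) \<le> 1 / c * (1 / norm a) ^ word_length \<sigma>"
    if "\<sigma> \<in> Sigma_seqs d" "norm (w - b) \<le> norm (v - b) \<or> \<sigma> \<in> Sigma_seqs' d \<and> v = b" for \<sigma> v
  proof -
    have "0 < c * norm a ^ word_length \<sigma>"
      using c(1) a_nonzero by simp
    then have "inverse (norm (G \<sigma> v)) \<le> inverse (c * norm a ^ word_length \<sigma>)"
      by (rule le_imp_inverse_le[OF c(2)[OF that]])
    then show ?thesis
      by (simp add: divide_inverse norm_inverse power_inverse)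
  qed
  show "(\<lambda>\<sigma>. norm (1 / G \<sigma> w)) summable_on Sigma_seqs d"
    by (rule summable_on_comparison_test[OF M le]) auto
  show "(\<lambda>\<sigma>. norm (1 / G \<sigma> b)) summable_on Sigma_seqs' d"
    by (rule summable_on_comparison_test[OF summable_on_subset[OF M] le])
      (auto simp: Sigma_seqs'_def)
qed

subsection \<open>Factorization of the Poincare function\<close>

text \<open>Telescoping: along the orbit, \<open>Q\<close> at a point is the quotient of the
  distances to \<open>b\<close> of the preceding point and of the point itself. The product starts
  after an orbit point different from \<open>b\<close>.\<close>

lemma prod_g_factor:
  assumes \<sigma>: "\<sigma> \<in> Sigma_seqs d" and neq: "orb \<sigma> m w \<noteq> b"
  shows "(\<Prod>k<n. g_factor P b B \<sigma> w (k + Suc m))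
           = a ^ n * (orb \<sigma> (n + m) w - b) / (orb \<sigma> m w - b)"
    and "g_factor P b B \<sigma> w (n + Suc m) \<noteq> 0"
proof -
  have eq: "orb \<sigma> (k + m) w - b = (orb \<sigma> (Suc k + m) w - b) * poly Q (orb \<sigma> (Suc k + m) w)" for k
    using P_orb[OF \<sigma>, of "k + m" w] by (simp flip: poly_P_minus_b del: backorbit.simps)
  have nz: "orb \<sigma> (k + m) w - b \<noteq> 0" for k
    using orb_neq_b[OF \<sigma> _ neq, of "k + m"] by simp
  have Qnz: "poly Q (orb \<sigma> (Suc k + m) w) \<noteq> 0" for k
    using eq[of k] nz[of k] by auto
  show "g_factor P b B \<sigma> w (n + Suc m) \<noteq> 0"
    using Qnz[of n] a_nonzero by (simp add: g_factor_def del: backorbit.simps flip: multiplier)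
  show "(\<Prod>k<n. g_factor P b B \<sigma> w (k + Suc m))
           = a ^ n * (orb \<sigma> (n + m) w - b) / (orb \<sigma> m w - b)"
  proof (induction n)
    case (Suc n)
    have "g_factor P b B \<sigma> w (n + Suc m) = a / poly Q (orb \<sigma> (Suc n + m) w)"
      by (simp add: g_factor_def del: backorbit.simps flip: multiplier)
    then show ?case
      unfolding prod.lessThan_Suc Suc eq[of n] using Qnz[of n] by simp
  qed (use nz[of 0] in simp)
qed

text \<open>\<open>convergent_prod\<close> requires a nonzero limit here, which
  \<open>G_limit\<close> provides. The case \<open>m = 0\<close> gives \<open>g_sigma\<close>;
  \<open>m = 1\<close> gives \<open>g_sigma0\<close> with the extra factor \<open>a\<close>.\<close>

lemma g_factor_product:
  assumes \<sigma>: "\<sigma> \<in> Sigma_seqs d" and neq: "orb \<sigma> m w \<noteq> b"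
  shows "convergent_prod (\<lambda>n. g_factor P b B \<sigma> w (n + Suc m))"
    and "a ^ m * ((orb \<sigma> m w - b) * (\<Prod>n. g_factor P b B \<sigma> w (n + Suc m))) = G \<sigma> w"
proof -
  define L where "L = G \<sigma> w / (a ^ m * (orb \<sigma> m w - b))"
  have L: "L \<noteq> 0"
    using G_limit(2)[OF assms] neq a_nonzero by (simp add: L_def)
  have "(\<lambda>n. a ^ (n + m) * (orb \<sigma> (n + m) w - b)) \<longlonglongrightarrow> G \<sigma> w"
    using G_limit(1)[OF assms] by (rule LIMSEQ_ignore_initial_segment)
  then have "(\<lambda>n. a ^ (n + m) * (orb \<sigma> (n + m) w - b) / (a ^ m * (orb \<sigma> m w - b))) \<longlonglongrightarrow> L"
    unfolding L_def using neq a_nonzero by (intro tendsto_divide tendsto_const) auto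
  moreover have "a ^ (n + m) * (orb \<sigma> (n + m) w - b) / (a ^ m * (orb \<sigma> m w - b))
      = (\<Prod>k<n. g_factor P b B \<sigma> w (k + Suc m))" for n
    unfolding prod_g_factor(1)[OF assms] using a_nonzero by (simp add: power_add)
  ultimately have lim: "(\<lambda>n. \<Prod>k\<le>n. g_factor P b B \<sigma> w (k + Suc m)) \<longlonglongrightarrow> L"
    by (simp add: LIMSEQ_lessThan_iff_atMost)
  then show conv: "convergent_prod (\<lambda>n. g_factor P b B \<sigma> w (n + Suc m))"
    using L by (subst convergent_prod_iff_nz_lim[OF prod_g_factor(2)[OF assms]]) blast
  have "(\<Prod>n. g_factor P b B \<sigma> w (n + Suc m)) = L"
    using LIMSEQ_unique[OF convergent_prod_LIMSEQ[OF conv] lim] .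
  then show "a ^ m * ((orb \<sigma> m w - b) * (\<Prod>n. g_factor P b B \<sigma> w (n + Suc m))) = G \<sigma> w"
    using neq a_nonzero by (simp add: L_def)
qed

lemma g_sigma_eq_G:
  assumes "\<sigma> \<in> Sigma_seqs d" "w \<noteq> b"
  shows "g_sigma P b B \<sigma> w = G \<sigma> w"
  using g_factor_product(2)[of \<sigma> 0 w] assms by (simp add: g_sigma_def)

lemma g_sigma0_eq_G:
  assumes "\<sigma> \<in> Sigma_seqs' d"
  shows "a * g_sigma0 P b B \<sigma> = G \<sigma> b"
  using g_factor_product(2)[of \<sigma> 1 b] orb_1_neq_b[OF assms] assms
  by (simp add: g_sigma0_def Sigma_seqs'_def)

lemma abs_convergent_factors:
  assumes "(\<lambda>\<sigma>. norm (1 / g \<sigma>)) summable_on A"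
  shows "abs_convergent_unordered_prod (\<lambda>\<sigma>. 1 - z / g \<sigma>) A"
proof (rule abs_convergent_unordered_prod_comparison)
  show "(\<lambda>\<sigma>. norm z * norm (1 / g \<sigma>)) summable_on A"
    by (intro summable_on_cmult_right assms)
qed (simp add: norm_divide)

proposition factorization_at_non_fixed_value:
  assumes w: "w \<noteq> b"
  shows "f z = w + (b - w) * unordered_prod (\<lambda>\<sigma>. 1 - z / G \<sigma> w) (Sigma_seqs d)"
proof -
  obtain c where c: "c > 0"
    "\<And>\<sigma> n v. \<sigma> \<in> words d n \<Longrightarrow> norm (w - b) \<le> norm (v - b) \<or> \<sigma> \<in> Sigma_seqs' d \<Longrightarrow>
       c * norm a ^ word_length \<sigma> \<le> norm (a ^ n * (orb \<sigma> n v - b))"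
    using scaled_orb_lower_bound[of "norm (w - b)"] w by auto
  \<comment> \<open>A convergent sequence is bounded: \<open>K\<close> dominates the numerators
    uniformly in \<open>n\<close>.\<close>
  obtain K where K: "K > 0" "\<And>n. norm (a ^ n * (f (z / a ^ n) - b)) \<le> K"
    using convergent_imp_Bseq[OF convergentI[OF f_scaled_tendsto[of z]]] by (auto simp: Bseq_def)
  \<comment> \<open>The factor \<open>a ^ n\<close> is inserted so that numerator and denominator
    converge separately.\<close>
  define u where "u = (\<lambda>n \<sigma>. (a ^ n * (f (z / a ^ n) - b)) / (a ^ n * (orb \<sigma> n w - b)))"
  define h where "h = (\<lambda>n \<sigma>. if \<sigma> \<in> words d n then 1 - u n \<sigma> else 1)"
  have "(\<lambda>n. unordered_prod (h n) (Sigma_seqs d))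
      \<longlonglongrightarrow> unordered_prod (\<lambda>\<sigma>. 1 - z / G \<sigma> w) (Sigma_seqs d)"
  proof (rule tannery_unordered_prod)
    show "(\<lambda>\<sigma>. K / c * (1 / norm a) ^ word_length \<sigma>) summable_on Sigma_seqs d"
      by (intro summable_on_cmult_right summable_on_Sigma_seqs d_pos deg_less)
  next
    fix n \<sigma>
    assume "\<sigma> \<in> Sigma_seqs d"
    show "norm (h n \<sigma> - 1) \<le> K / c * (1 / norm a) ^ word_length \<sigma>"
    proof (cases "\<sigma> \<in> words d n")
      case True
      have "norm (u n \<sigma>) \<le> K / (c * norm a ^ word_length \<sigma>)"
        unfolding u_def norm_divide using K c True a_nonzero
        by (intro frac_le) auto
      then show ?thesis
        using True by (simp add: h_def power_divide)
    next
      case False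
      then show ?thesis
        using K c by (simp add: h_def)
    qed
  next
    fix \<sigma>
    assume \<sigma>: "\<sigma> \<in> Sigma_seqs d"
    have "(\<lambda>n. 1 - u n \<sigma>) \<longlonglongrightarrow> 1 - z / G \<sigma> w"
      unfolding u_def using G_limit[OF \<sigma>, of 0 w] w
      by (intro tendsto_diff tendsto_divide tendsto_const f_scaled_tendsto) auto
    moreover have "eventually (\<lambda>n. 1 - u n \<sigma> = h n \<sigma>) sequentially"
      using eventually_in_words[OF d_pos \<sigma>] by eventually_elim (simp add: h_def)
    ultimately show "(\<lambda>n. h n \<sigma>) \<longlonglongrightarrow> 1 - z / G \<sigma> w"
      by (rule Lim_transform_eventually)
  qed
  \<comment> \<open>The finite factorization is exact, so the convergent sequence is in fact
    constant.\<close>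
  moreover have "unordered_prod (h n) (Sigma_seqs d) = (f z - w) / (b - w)" for n
  proof -
    have "unordered_prod (h n) (Sigma_seqs d) = prod (h n) (words d n)"
      by (rule unordered_prod_finite_support) (use words_subset in \<open>auto simp: card_words[OF d_pos] h_def\<close>)
    also have "\<dots> = (\<Prod>\<sigma>\<in>words d n. (f (z / a ^ n) - orb \<sigma> n w) / (b - orb \<sigma> n w))"
    proof (rule prod.cong[OF refl])
      fix \<sigma> assume s: "\<sigma> \<in> words d n"
      then have "orb \<sigma> n w \<noteq> b"
        using orb_neq_b[of \<sigma> 0 n w] w words_subset by auto
      then show "h n \<sigma> = (f (z / a ^ n) - orb \<sigma> n w) / (b - orb \<sigma> n w)"
        using s a_nonzero by (simp add: h_def u_def divide_simps) (simp add: algebra_simps)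
    qed
    also have "\<dots> = (f z - w) / (b - w)"
      unfolding P_iter_quotient[OF w, symmetric] using f_scaling[of z n] by simp
    finally show ?thesis .
  qed
  ultimately have "unordered_prod (\<lambda>\<sigma>. 1 - z / G \<sigma> w) (Sigma_seqs d) = (f z - w) / (b - w)"
    by (simp add: LIMSEQ_const_iff)
  then show ?thesis
    using w by simp
qed

text \<open>Regrouping by the first digit is done on finite sets of words, where it is a bijection;
  both sides then converge. The digit \<open>i\<close> contributes the factorization at the value
  \<open>B i b\<close>.\<close>

lemma Q_f_factorization:
  "poly Q (f z) = a * unordered_prod (\<lambda>\<tau>. 1 - a * z / G \<tau> b) (Sigma_seqs' d)"
proof -
  have Bb: "B i b \<noteq> b" if "i \<in> {1..<d}" for i
    using B_b_neq that .
  have "1 \<in> {1..<d}"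
    using deg by simp
  then have summ: "(\<lambda>\<tau>. norm (1 / G \<tau> b)) summable_on Sigma_seqs' d"
    using summable_on_inverse_G(2) Bb by blast
  have "(\<lambda>n. \<Prod>\<tau>\<in>words' d n. 1 - a * z / G \<tau> b)
      \<longlonglongrightarrow> unordered_prod (\<lambda>\<tau>. 1 - a * z / G \<tau> b) (Sigma_seqs' d)"
    by (intro prod_exhaustion_tendsto_unordered_prod abs_convergent_factors summ
        finite_words' d_pos words'_subset eventually_in_words')
  \<comment> \<open>The shift matches a first digit followed by a word in
    \<open>words d n\<close>.\<close>
  then have "(\<lambda>n. \<Prod>\<tau>\<in>words' d (Suc n). 1 - a * z / G \<tau> b)
      \<longlonglongrightarrow> unordered_prod (\<lambda>\<tau>. 1 - a * z / G \<tau> b) (Sigma_seqs' d)"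
    by (rule LIMSEQ_Suc)
  moreover have "(\<Prod>\<tau>\<in>words' d (Suc n). 1 - a * z / G \<tau> b)
      = (\<Prod>i\<in>{1..<d}. \<Prod>\<sigma>\<in>words d n. 1 - z / G \<sigma> (B i b))" for n
    unfolding prod_words'_Suc[OF d_pos]
  proof (intro prod.cong refl)
    fix i \<sigma>
    assume i: "i \<in> {1..<d}" and "\<sigma> \<in> words d n"
    then have "\<sigma> \<in> Sigma_seqs d"
      using words_subset by blast
    then show "1 - a * z / G (word_Cons i \<sigma>) b = 1 - z / G \<sigma> (B i b)"
      using G_word_Cons[of \<sigma> i] Bb[OF i] i a_nonzero by simp
  qed
  moreover have "(\<lambda>n. \<Prod>i\<in>{1..<d}. \<Prod>\<sigma>\<in>words d n. 1 - z / G \<sigma> (B i b))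
      \<longlonglongrightarrow> (\<Prod>i\<in>{1..<d}. unordered_prod (\<lambda>\<sigma>. 1 - z / G \<sigma> (B i b)) (Sigma_seqs d))"
    by (intro tendsto_prod prod_exhaustion_tendsto_unordered_prod abs_convergent_factors
        summable_on_inverse_G(1) Bb card_words d_pos words_subset eventually_in_words)
  ultimately have "unordered_prod (\<lambda>\<tau>. 1 - a * z / G \<tau> b) (Sigma_seqs' d)
      = (\<Prod>i\<in>{1..<d}. unordered_prod (\<lambda>\<sigma>. 1 - z / G \<sigma> (B i b)) (Sigma_seqs d))"
    using LIMSEQ_unique by simp
  also have "\<dots> = (\<Prod>i\<in>{1..<d}. (f z - B i b) / (b - B i b))"
  proof (intro prod.cong refl)
    fix i
    assume i: "i \<in> {1..<d}"
    show "unordered_prod (\<lambda>\<sigma>. 1 - z / G \<sigma> (B i b)) (Sigma_seqs d) = (f z - B i b) / (b - B i b)"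
      using factorization_at_non_fixed_value[OF Bb[OF i], of z] Bb[OF i]
      by (simp add: field_simps)
  qed
  finally show ?thesis
    by (simp add: poly_Q_eq_prod)
qed

text \<open>Each \<open>Q\<close> is divided by its value \<open>a\<close> at \<open>b\<close>; the
  compensating \<open>a ^ N\<close> makes the leading factor tend to \<open>z\<close>.\<close>

lemma f_minus_b_telescope:
  "f z - b = a ^ N * (f (z / a ^ N) - b) * (\<Prod>m<N. poly Q (f (z / a ^ Suc m)) / a)"
proof (induction N)
  case (Suc N)
  have "f (z / a ^ N) = poly P (f (z / a ^ Suc N))"
    using poincare[of "z / a ^ Suc N"] a_nonzero by simp
  then have "f (z / a ^ N) - b = (f (z / a ^ Suc N) - b) * poly Q (f (z / a ^ Suc N))"
    by (simp add: poly_P_minus_b)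
  then show ?case
    using Suc a_nonzero by (simp add: mult_ac)
qed simp

proposition factorization_at_fixed_point:
  defines "\<alpha> \<equiv> (\<lambda>z \<tau>. z / G \<tau> b)"
  shows "convergent_prod (\<lambda>n. 1 - \<alpha> z \<tau> * (1 / a) ^ n)"
    and "abs_convergent_unordered_prod (\<lambda>\<tau>. \<Prod>n. 1 - \<alpha> z \<tau> * (1 / a) ^ n) (Sigma_seqs' d)"
    and "abs_convergent_unordered_prod (\<lambda>\<tau>. 1 - \<alpha> z \<tau> * (1 / a) ^ m) (Sigma_seqs' d)"
    and "convergent_prod (\<lambda>m. unordered_prod (\<lambda>\<tau>. 1 - \<alpha> z \<tau> * (1 / a) ^ m) (Sigma_seqs' d))"
    and "f z = b + z * unordered_prod (\<lambda>\<tau>. \<Prod>n. 1 - \<alpha> z \<tau> * (1 / a) ^ n) (Sigma_seqs' d)"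
    and "f z = b + z * (\<Prod>m. unordered_prod (\<lambda>\<tau>. 1 - \<alpha> z \<tau> * (1 / a) ^ m) (Sigma_seqs' d))"
proof -
  have "B 1 b \<noteq> b"
    using B_b_neq[of 1] deg by simp
  note summ = summable_on_inverse_G(2)[OF this]
  have "(\<lambda>\<tau>. norm z * norm (1 / G \<tau> b)) summable_on Sigma_seqs' d"
    by (intro summable_on_cmult_right summ)
  then have t: "(\<lambda>\<tau>. norm (\<alpha> z \<tau>)) summable_on Sigma_seqs' d"
    by (simp add: \<alpha>_def norm_divide)
  show "convergent_prod (\<lambda>n. 1 - \<alpha> z \<tau> * (1 / a) ^ n)"
    and "abs_convergent_unordered_prod (\<lambda>\<tau>. \<Prod>n. 1 - \<alpha> z \<tau> * (1 / a) ^ n) (Sigma_seqs' d)"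
    and conv: "convergent_prod (\<lambda>m. unordered_prod (\<lambda>\<tau>. 1 - \<alpha> z \<tau> * (1 / a) ^ m) (Sigma_seqs' d))"
    by (rule unordered_prod_geometric_swap[OF repelling t])+
  show "abs_convergent_unordered_prod (\<lambda>\<tau>. 1 - \<alpha> z \<tau> * (1 / a) ^ m) (Sigma_seqs' d)"
    using abs_convergent_factors[OF summ, of "z / a ^ m"] by (simp add: \<alpha>_def power_divide mult.commute)
  \<comment> \<open>The \<open>a\<close> multiplying the argument in
    \<open>Q_f_factorization\<close> cancels one power of \<open>a ^ Suc m\<close>, so the exponent
    starts at 0.\<close>
  have factor: "poly Q (f (z / a ^ Suc m)) / a
      = unordered_prod (\<lambda>\<tau>. 1 - \<alpha> z \<tau> * (1 / a) ^ m) (Sigma_seqs' d)" for m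
    unfolding Q_f_factorization using a_nonzero by (simp add: \<alpha>_def power_divide mult.commute)
  define L where "L = unordered_prod (\<lambda>\<tau>. \<Prod>n. 1 - \<alpha> z \<tau> * (1 / a) ^ n) (Sigma_seqs' d)"
  have lim: "(\<lambda>N. \<Prod>m<N. unordered_prod (\<lambda>\<tau>. 1 - \<alpha> z \<tau> * (1 / a) ^ m) (Sigma_seqs' d)) \<longlonglongrightarrow> L"
    unfolding L_def by (rule unordered_prod_geometric_swap(4)[OF repelling t])
  have "(\<lambda>N. a ^ N * (f (z / a ^ N) - b) * (\<Prod>m<N. poly Q (f (z / a ^ Suc m)) / a)) \<longlonglongrightarrow> z * L"
    unfolding factor by (intro tendsto_mult f_scaled_tendsto lim)
  then have "f z - b = z * L"
    by (simp only: LIMSEQ_const_iff flip: f_minus_b_telescope)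
  then show *: "f z = b + z * unordered_prod (\<lambda>\<tau>. \<Prod>n. 1 - \<alpha> z \<tau> * (1 / a) ^ n) (Sigma_seqs' d)"
    unfolding L_def by (simp add: algebra_simps)
  have "(\<Prod>m. unordered_prod (\<lambda>\<tau>. 1 - \<alpha> z \<tau> * (1 / a) ^ m) (Sigma_seqs' d)) = L"
    using LIMSEQ_unique[OF convergent_prod_LIMSEQ[OF conv]] lim
    by (simp add: LIMSEQ_lessThan_iff_atMost)
  then show "f z = b + z * (\<Prod>m. unordered_prod (\<lambda>\<tau>. 1 - \<alpha> z \<tau> * (1 / a) ^ m) (Sigma_seqs' d))"
    using * by (simp add: L_def)
qed

end

text \<open>Infinite products here are total functions, so convergence and nonvanishing are asserted
  beside each identity. The proof translates \<open>G\<close> back into \<open>g_sigma\<close> and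
  \<open>a * g_sigma0\<close>.\<close>

theorem corollary1p4:
  fixes P :: "complex poly" and a b :: complex and f :: "complex \<Rightarrow> complex"
    and B :: "nat \<Rightarrow> complex \<Rightarrow> complex"
  assumes deg: "degree P \<ge> 2"
    and b_nonzero: "b \<noteq> 0"
    and fixed: "poly P b = b"
    and multiplier: "a = poly (pderiv P) b"
    and repelling: "norm a > 1"
    and entire: "f holomorphic_on UNIV"
    and poincare: "\<And>z. f (a * z) = poly P (f z)"
    and f_0: "f 0 = b"
    and f'_0: "deriv f 0 = 1"
    and branches: "inverse_branches P b B"
    and hypothesis1: "\<And>w. (\<lambda>n. (B 0 ^^ n) w) \<longlonglongrightarrow> b"
    and deg_less: "real (degree P) < norm a"
  shows
    "(\<forall>w. w \<noteq> b \<longrightarrow>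
        (\<forall>\<sigma>\<in>Sigma_seqs (degree P).
           convergent_prod (\<lambda>n. g_factor P b B \<sigma> w (n + 1)) \<and> g_sigma P b B \<sigma> w \<noteq> 0) \<and>
        (\<forall>z. abs_convergent_unordered_prod (\<lambda>\<sigma>. 1 - z / g_sigma P b B \<sigma> w) (Sigma_seqs (degree P)) \<and>
             f z = w + (b - w) * unordered_prod (\<lambda>\<sigma>. 1 - z / g_sigma P b B \<sigma> w) (Sigma_seqs (degree P))))
     \<and>
     (\<forall>\<sigma>\<in>Sigma_seqs (degree P).
        convergent_prod (\<lambda>n. poly (Qpoly P b) (backorbit B \<sigma> (n + 1) 0) / a)) \<and>
     (\<forall>z. abs_convergent_unordered_prod
            (\<lambda>\<sigma>. 1 + z / b * (\<Prod>n. poly (Qpoly P b) (backorbit B \<sigma> (n + 1) 0) / a))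
            (Sigma_seqs (degree P)) \<and>
          f z = b * unordered_prod
            (\<lambda>\<sigma>. 1 + z / b * (\<Prod>n. poly (Qpoly P b) (backorbit B \<sigma> (n + 1) 0) / a))
            (Sigma_seqs (degree P)))
     \<and>
     (\<forall>\<sigma>\<in>Sigma_seqs' (degree P).
        convergent_prod (\<lambda>n. g_factor P b B \<sigma> b (n + 2)) \<and> g_sigma0 P b B \<sigma> \<noteq> 0) \<and>
     (\<forall>z. (\<forall>m. abs_convergent_unordered_prod
                 (\<lambda>\<sigma>. 1 - z / (a ^ m * (a * g_sigma0 P b B \<sigma>))) (Sigma_seqs' (degree P))) \<and>
          convergent_prod
            (\<lambda>m. unordered_prod (\<lambda>\<sigma>. 1 - z / (a ^ m * (a * g_sigma0 P b B \<sigma>))) (Sigma_seqs' (degree P))) \<and>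
          f z = b + z *
            (\<Prod>m. unordered_prod (\<lambda>\<sigma>. 1 - z / (a ^ m * (a * g_sigma0 P b B \<sigma>))) (Sigma_seqs' (degree P))))
     \<and>
     (\<forall>z. (\<forall>\<sigma>\<in>Sigma_seqs' (degree P).
             convergent_prod (\<lambda>n. 1 - z / (a * g_sigma0 P b B \<sigma>) * (1 / a) ^ n)) \<and>
          abs_convergent_unordered_prod
            (\<lambda>\<sigma>. \<Prod>n. 1 - z / (a * g_sigma0 P b B \<sigma>) * (1 / a) ^ n) (Sigma_seqs' (degree P)) \<and>
          f z = b + q_pochhammer
            (\<lambda>\<sigma>. z / (a * g_sigma0 P b B \<sigma>)) (Sigma_seqs' (degree P)) (1 / a) * z)"
proof -
  interpret poincare_function P a b f B
    by unfold_locales (use assms in auto)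
  have i: "convergent_prod (\<lambda>n. g_factor P b B \<sigma> w (n + 1))" "g_sigma P b B \<sigma> w \<noteq> 0"
    if "w \<noteq> b" "\<sigma> \<in> Sigma_seqs d" for w \<sigma>
    using g_factor_product(1)[of \<sigma> 0 w] G_limit(2)[of \<sigma> 0 w] g_sigma_eq_G[of \<sigma> w] that by auto
  have i_abs: "abs_convergent_unordered_prod (\<lambda>\<sigma>. 1 - z / g_sigma P b B \<sigma> w) (Sigma_seqs d)"
    if "w \<noteq> b" for w z
    using abs_convergent_factors[OF summable_on_inverse_G(1)[OF that], of z]
    by (rule abs_convergent_unordered_prod_cong[THEN iffD1, rotated]) (simp add: g_sigma_eq_G that)
  have i_prod: "f z = w + (b - w) * unordered_prod (\<lambda>\<sigma>. 1 - z / g_sigma P b B \<sigma> w) (Sigma_seqs d)"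
    if "w \<noteq> b" for w z
  proof -
    have "unordered_prod (\<lambda>\<sigma>. 1 - z / G \<sigma> w) (Sigma_seqs d)
        = unordered_prod (\<lambda>\<sigma>. 1 - z / g_sigma P b B \<sigma> w) (Sigma_seqs d)"
      by (rule unordered_prod_cong) (simp add: g_sigma_eq_G that)
    then show ?thesis
      using factorization_at_non_fixed_value[OF that, of z] by simp
  qed
  have inv: "poly Q (orb \<sigma> (n + 1) 0) / a = inverse (g_factor P b B \<sigma> 0 (n + 1))" for \<sigma> n
    by (simp add: g_factor_def flip: multiplier del: backorbit.simps)
  have zero_conv: "convergent_prod (\<lambda>n. poly Q (orb \<sigma> (n + 1) 0) / a)" if "\<sigma> \<in> Sigma_seqs d" for \<sigma>
    unfolding inv using i(1)[OF _ that, of 0] b_nonzero by (intro convergent_prod_inverse) auto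
  \<comment> \<open>The plus sign arises because the leading factor of \<open>g_sigma\<close> at
    \<open>w = 0\<close> is \<open>- b\<close>.\<close>
  have zero_factor: "1 + z / b * (\<Prod>n. poly Q (orb \<sigma> (n + 1) 0) / a) = 1 - z / g_sigma P b B \<sigma> 0"
    if "\<sigma> \<in> Sigma_seqs d" for \<sigma> z
    unfolding inv using prodinf_inverse[OF i(1)[OF _ that, of 0]] b_nonzero
    by (simp add: g_sigma_def divide_inverse)
  have zero_abs: "abs_convergent_unordered_prod
      (\<lambda>\<sigma>. 1 + z / b * (\<Prod>n. poly Q (orb \<sigma> (n + 1) 0) / a)) (Sigma_seqs d)" for z
    using i_abs[of 0 z] b_nonzero by (subst abs_convergent_unordered_prod_cong[OF zero_factor]) auto
  have zero_prod: "f z = b * unordered_prod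
      (\<lambda>\<sigma>. 1 + z / b * (\<Prod>n. poly Q (orb \<sigma> (n + 1) 0) / a)) (Sigma_seqs d)" for z
    using i_prod[of 0 z] b_nonzero by (subst unordered_prod_cong[OF zero_factor]) auto
  have ii: "convergent_prod (\<lambda>n. g_factor P b B \<sigma> b (n + 2))" "g_sigma0 P b B \<sigma> \<noteq> 0"
    if "\<sigma> \<in> Sigma_seqs' d" for \<sigma>
    using g_factor_product(1)[of \<sigma> 1 b] G_limit(2)[of \<sigma> 1 b] g_sigma0_eq_G[OF that]
      orb_1_neq_b[OF that] that by (auto simp: Sigma_seqs'_def)
  have term_eq: "1 - z / (a ^ m * (a * g_sigma0 P b B \<sigma>)) = 1 - z / G \<sigma> b * (1 / a) ^ m"
    if "\<sigma> \<in> Sigma_seqs' d" for z m \<sigma>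
    by (simp add: g_sigma0_eq_G[OF that] power_divide mult.commute)
  have ii_abs: "abs_convergent_unordered_prod (\<lambda>\<sigma>. 1 - z / (a ^ m * (a * g_sigma0 P b B \<sigma>))) (Sigma_seqs' d)"
    for z m
    using factorization_at_fixed_point(3)[of z m]
    by (subst abs_convergent_unordered_prod_cong[OF term_eq])
  have uprod_eq: "unordered_prod (\<lambda>\<sigma>. 1 - z / (a ^ m * (a * g_sigma0 P b B \<sigma>))) (Sigma_seqs' d)
      = unordered_prod (\<lambda>\<sigma>. 1 - z / G \<sigma> b * (1 / a) ^ m) (Sigma_seqs' d)" for z m
    by (rule unordered_prod_cong[OF term_eq])
  have qterm_eq: "1 - z / (a * g_sigma0 P b B \<sigma>) * (1 / a) ^ n = 1 - z / G \<sigma> b * (1 / a) ^ n"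
    if "\<sigma> \<in> Sigma_seqs' d" for z n \<sigma>
    by (simp add: g_sigma0_eq_G[OF that])
  have q_conv: "convergent_prod (\<lambda>n. 1 - z / (a * g_sigma0 P b B \<sigma>) * (1 / a) ^ n)"
    if "\<sigma> \<in> Sigma_seqs' d" for z \<sigma>
    unfolding qterm_eq[OF that] by (rule factorization_at_fixed_point(1))
  have q_eq: "(\<Prod>n. 1 - z / (a * g_sigma0 P b B \<sigma>) * (1 / a) ^ n) = (\<Prod>n. 1 - z / G \<sigma> b * (1 / a) ^ n)"
    if "\<sigma> \<in> Sigma_seqs' d" for z \<sigma>
    unfolding qterm_eq[OF that] ..
  have q_abs: "abs_convergent_unordered_prod
      (\<lambda>\<sigma>. \<Prod>n. 1 - z / (a * g_sigma0 P b B \<sigma>) * (1 / a) ^ n) (Sigma_seqs' d)" for z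
    using factorization_at_fixed_point(2)[of z]
    by (subst abs_convergent_unordered_prod_cong[OF q_eq])
  have q_prod: "f z = b + q_pochhammer
      (\<lambda>\<sigma>. z / (a * g_sigma0 P b B \<sigma>)) (Sigma_seqs' d) (1 / a) * z" for z
    unfolding q_pochhammer_def using factorization_at_fixed_point(5)[of z]
    by (subst unordered_prod_cong[OF q_eq]) (simp_all add: mult.commute)
  show ?thesis
    unfolding uprod_eq
    by (intro conjI allI ballI impI)
      (rule i i_abs i_prod zero_conv zero_abs zero_prod ii ii_abs q_conv q_abs q_prod
        factorization_at_fixed_point(4,6); assumption)+
qed

end
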